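(* For five points drawn independently from the standard normal distribution in $\mathbb{R}^3$, the probability that the points are in convex position is $$\Pr(X_3 = 2) = \frac12 + \frac5\pi \arcsin\left(\frac14\right) \approx .902.$$
   Context: Points are in convex position if none of them lies in the convex hull of the others. Radon's theorem: any $d+2$ points in $\mathbb{R}^d$ can be partitioned into two sets whose convex hulls intersect; such a partition is called a Radon partition, and if the points are in general position it is unique up to swapping the two sets. $X_d$ is the random variable equal to the number of points in the smaller side of the (almost surely unique) Radon partition of $d+2$ independent standard Gaussian points in $\mathbb{R}^d$; thus, almost surely, the points are in convex position if and only if $X_d \neq 1$. *)

theory Defs
  imports "HOL-Probability.Probability"
begin

text \<open>Density of the standard normal distribution on a Euclidean space: the coordinates with
  respect to the orthonormal basis are independent standard normal reals.\<close>

definition std_gaussian_density :: "'a::euclidean_space \<Rightarrow> real" where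
  "std_gaussian_density x = (\<Prod>b\<in>Basis. std_normal_density (x \<bullet> b))"

text \<open>Point configurations are indexed families, so that coinciding points are counted with
  multiplicity (and are, in particular, not in convex position).\<close>

definition convex_position :: "'i set \<Rightarrow> ('i \<Rightarrow> 'a::real_vector) \<Rightarrow> bool" where
  "convex_position I x \<longleftrightarrow> (\<forall>i\<in>I. x i \<notin> convex hull (x ` (I - {i})))"

definition radon_partition ::
    "'i set \<Rightarrow> ('i \<Rightarrow> 'a::real_vector) \<Rightarrow> 'i set \<Rightarrow> 'i set \<Rightarrow> bool" where
  "radon_partition I x A B \<longleftrightarrow>
     A \<union> B = I \<and> A \<inter> B = {} \<and> convex hull (x ` A) \<inter> convex hull (x ` B) \<noteq> {}"

text \<open>For \<open>d + 2\<close> independent Gaussian points in dimension \<open>d\<close> the Radon partition is almost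
  surely unique up to swapping the sides; the \<open>LEAST\<close> only fixes a value on the exceptional null
  set where there are several Radon partitions.\<close>

definition radon_smaller_side :: "'i set \<Rightarrow> ('i \<Rightarrow> 'a::real_vector) \<Rightarrow> nat" where
  "radon_smaller_side I x =
     (LEAST k. \<exists>A B. radon_partition I x A B \<and> k = min (card A) (card B))"

lemma radon_smaller_side_unique:
  assumes "radon_partition I x A B"
    and "\<And>A' B'. radon_partition I x A' B' \<Longrightarrow> (A' = A \<and> B' = B) \<or> (A' = B \<and> B' = A)"
  shows "radon_smaller_side I x = min (card A) (card B)"
  unfolding radon_smaller_side_def
proof (rule Least_equality)
  show "\<exists>A' B'. radon_partition I x A' B' \<and> min (card A) (card B) = min (card A') (card B')"
    using assms(1) by blast
  show "min (card A) (card B) \<le> k"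
    if "\<exists>A' B'. radon_partition I x A' B' \<and> k = min (card A') (card B')" for k
    using that assms(2) by (metis min.commute order_refl)
qed

end

(*
  Almost surely the five points have, up to scaling, a unique affine dependence, and all its
  coefficients are non-zero. They are not in convex position iff its sign pattern is 1-4, in
  which case 6 of the 10 pairs of coefficients have equal signs; for the pattern 2-3 there are
  4 such pairs. Hence 10 s = 6 (1 - P) + 4 P, where P is the wanted probability and s the
  probability that two given coefficients have equal signs, i.e. that two given points lie on
  opposite sides of the plane through the other three.

  The centroid of the three points is independent of their differences, hence of the normal n
  of the plane, and has covariance 1/3 of the identity. So, conditionally on n, the question is
  whether two standard normals lie on different sides of an independent normal of variance 1/3;
  this gives s = (2/pi) arctan (sqrt (3/5)) = 1/2 - arcsin (1/4) / pi.
*)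

theory Submission
  imports Defs
begin

section \<open>The standard Gaussian measure\<close>

text \<open>The number 1/4 is a correlation: for a fixed unit normal \<open>n\<close>, the signed
  distances of the two tested points from the plane share the centroid term of variance 1/3 and each
  has variance 1 + 1/3, so they correlate by (1/3) / (4/3). Two centred normals of correlation
  \<rho> have opposite signs with probability 1/2 - arcsin \<rho> / \<pi>. Independence of Gaussian
  combinations is not argued through covariances. All probabilities are iterated nonnegative
  integrals, and a combination is decoupled by rotating a pair of variables, under which the product
  of two standard Gaussians is invariant; Fubini then puts the variables in the order needed. The
  link between coefficients and planes is that the signed distance to a plane is an affine function:
  an affine dependence annihilates it, and the three points on the plane drop out of the sum.
  Uniqueness of the dependence up to scaling is replaced by a weaker fact, that all dependences have
  the same relative signs and no zero coefficients. The link between Radon partitions and convex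
  position is deterministic, with no exceptional null set.\<close>

definition std_gaussian :: "'a::euclidean_space measure" where
  "std_gaussian = density lborel (\<lambda>x. ennreal (std_gaussian_density x))"

lemma std_gaussian_density_eq:
  "std_gaussian_density (x::'a::euclidean_space)
     = (1 / sqrt (2 * pi)) ^ DIM('a) * exp (- (norm x)\<^sup>2 / 2)"
proof -
  have "(norm x)\<^sup>2 = (\<Sum>b\<in>Basis. (x \<bullet> b)\<^sup>2)"
    unfolding power2_norm_eq_inner by (subst euclidean_inner) (simp add: power2_eq_square)
  then show ?thesis
    unfolding std_gaussian_density_def std_normal_density_def
    by (simp add: prod_dividef power_divide exp_sum[symmetric] sum_negf sum_divide_distrib)
qed

lemma std_gaussian_density_nonneg: "0 \<le> std_gaussian_density x"
  by (simp add: std_gaussian_density_eq)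

lemma std_gaussian_density_real: "std_gaussian_density x = std_normal_density x" for x :: real
  by (simp add: std_gaussian_density_def)

lemma measurable_std_gaussian_density [measurable]:
  "std_gaussian_density \<in> borel_measurable (borel :: 'a::euclidean_space measure)"
  unfolding std_gaussian_density_def[abs_def] by measurable

lemma sets_std_gaussian [simp, measurable_cong]: "sets std_gaussian = sets borel"
  by (simp add: std_gaussian_def)

lemma space_std_gaussian [simp]: "space std_gaussian = UNIV"
  by (simp add: std_gaussian_def)

text \<open>Density and Lebesgue measure both factor over the coordinates. This supplies the total
  mass and, as boxes generate the product sigma-algebra, the law and the independence of the
  coordinates.\<close>

lemma emeasure_std_gaussian_box:
  assumes [measurable]: "\<And>b. b \<in> Basis \<Longrightarrow> A b \<in> sets borel"
  shows "emeasure std_gaussian {x::'a::euclidean_space. \<forall>b\<in>Basis. x \<bullet> b \<in> A b} =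
    (\<Prod>b\<in>Basis. emeasure (density lborel (\<lambda>x. ennreal (std_normal_density x))) (A b))"
proof -
  have *: "{x::'a. \<forall>b\<in>Basis. x \<bullet> b \<in> A b} \<in> sets borel"
    by (measurable)
  have "emeasure std_gaussian {x::'a. \<forall>b\<in>Basis. x \<bullet> b \<in> A b} =
     (\<integral>\<^sup>+x. ennreal (std_gaussian_density x) * indicator {x::'a. \<forall>b\<in>Basis. x \<bullet> b \<in> A b} x \<partial>lborel)"
    unfolding std_gaussian_def using * by (subst emeasure_density) auto
  also have "\<dots> = (\<integral>\<^sup>+x. (\<Prod>b\<in>Basis. ennreal (std_normal_density (x \<bullet> b)) * indicator (A b) ((x::'a) \<bullet> b)) \<partial>lborel)"
  proof (intro nn_integral_cong)
    fix x :: 'a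
    have "(\<Prod>b\<in>Basis. indicator (A b) (x \<bullet> b)) = (indicator {x::'a. \<forall>b\<in>Basis. x \<bullet> b \<in> A b} x :: ennreal)"
      by (auto simp: indicator_def prod.If_cases split: if_splits intro!: prod.neutral)
    then show "ennreal (std_gaussian_density x) * indicator {x::'a. \<forall>b\<in>Basis. x \<bullet> b \<in> A b} x =
      (\<Prod>b\<in>Basis. ennreal (std_normal_density (x \<bullet> b)) * indicator (A b) (x \<bullet> b))"
      unfolding prod.distrib std_gaussian_density_def by (subst prod_ennreal) auto
  qed
  also have "\<dots> = (\<Prod>b\<in>Basis. emeasure (density lborel (\<lambda>x. ennreal (std_normal_density x))) (A b))"
    by (subst nn_integral_lborel_prod) (auto simp: emeasure_density intro!: prod.cong)
  finally show ?thesis .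
qed

lemma prob_space_std_gaussian: "prob_space (std_gaussian :: 'a::euclidean_space measure)"
proof
  show "emeasure (std_gaussian :: 'a measure) (space std_gaussian) = 1"
    using emeasure_std_gaussian_box[of "\<lambda>_::'a. UNIV"]
      prob_space.emeasure_space_1[OF prob_space_normal_density[of 1 0]] by simp
qed

interpretation std_gaussian: prob_space "std_gaussian :: 'a::euclidean_space measure"
  by (rule prob_space_std_gaussian)

interpretation std_gaussian_pair:
  pair_sigma_finite "std_gaussian :: 'a::euclidean_space measure" "std_gaussian :: 'b::euclidean_space measure"
  ..

lemma nn_integral_std_gaussian:
  assumes [measurable]: "f \<in> borel_measurable borel"
  shows "(\<integral>\<^sup>+x. f x \<partial>std_gaussian) = (\<integral>\<^sup>+x. ennreal (std_gaussian_density x) * f x \<partial>lborel)"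
  unfolding std_gaussian_def by (rule nn_integral_density) auto

section \<open>Linear substitutions and rotation invariance\<close>

lemma nn_integral_lborel_affine:
  fixes t :: "'a::euclidean_space"
  assumes [measurable]: "f \<in> borel_measurable borel" and "c \<noteq> 0"
  shows "(\<integral>\<^sup>+x. f x \<partial>lborel) = ennreal (\<bar>c\<bar> ^ DIM('a)) * (\<integral>\<^sup>+x. f (t + c *\<^sub>R x) \<partial>lborel)"
  by (subst lborel_affine[OF \<open>c \<noteq> 0\<close>, of t])
     (simp add: nn_integral_density nn_integral_distr nn_integral_cmult)

text \<open>The product density depends only on the sum of the two squared norms, which the rotation
  with cosine \<open>a\<close> and sine \<open>b\<close> preserves. This invariance does the work of
  independence throughout: two orthogonal combinations of a Gaussian pair may be treated as a fresh
  pair. The factorisation into one-variable substitutions divides by \<open>a\<close>.\<close>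

lemma nn_integral_std_gaussian_rotate:
  fixes F :: "'a::euclidean_space \<Rightarrow> 'a \<Rightarrow> ennreal"
  assumes [measurable]: "case_prod F \<in> borel_measurable (borel \<Otimes>\<^sub>M borel)"
    and ab: "a\<^sup>2 + b\<^sup>2 = 1" and "a \<noteq> 0"
  shows "(\<integral>\<^sup>+x. \<integral>\<^sup>+y. F (a *\<^sub>R x - b *\<^sub>R y) (b *\<^sub>R x + a *\<^sub>R y) \<partial>std_gaussian \<partial>std_gaussian) =
    (\<integral>\<^sup>+x. \<integral>\<^sup>+y. F x y \<partial>std_gaussian \<partial>std_gaussian)"
proof -
  define P where "P u v = ennreal (std_gaussian_density u) * (ennreal (std_gaussian_density v) * F u v)" for u v
  have [measurable]: "case_prod P \<in> borel_measurable (borel \<Otimes>\<^sub>M borel)"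
    unfolding P_def[abs_def] by measurable
  have density: "std_gaussian_density x * std_gaussian_density y =
      std_gaussian_density (a *\<^sub>R x - b *\<^sub>R y) * std_gaussian_density (b *\<^sub>R x + a *\<^sub>R y)" for x y :: 'a
  proof -
    have "(norm (a *\<^sub>R x - b *\<^sub>R y))\<^sup>2 + (norm (b *\<^sub>R x + a *\<^sub>R y))\<^sup>2 =
      (a\<^sup>2 + b\<^sup>2) * ((norm x)\<^sup>2 + (norm y)\<^sup>2)"
      unfolding power2_norm_eq_inner
      by (simp add: inner_diff_left inner_diff_right inner_add_left inner_add_right inner_commute[of y x]
          algebra_simps power2_eq_square)
    then have "exp (- (norm x)\<^sup>2 / 2) * exp (- (norm y)\<^sup>2 / 2) =
      exp (- (norm (a *\<^sub>R x - b *\<^sub>R y))\<^sup>2 / 2) * exp (- (norm (b *\<^sub>R x + a *\<^sub>R y))\<^sup>2 / 2)"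
      by (simp add: ab exp_add[symmetric] field_simps)
    then show ?thesis
      by (simp add: std_gaussian_density_eq)
  qed
  \<comment> \<open>The rotation is a composition of two substitutions, each affine in one variable with the
    other one fixed; their Jacobians cancel.\<close>
  have "(\<integral>\<^sup>+x. \<integral>\<^sup>+y. F x y \<partial>std_gaussian \<partial>std_gaussian) = (\<integral>\<^sup>+u. \<integral>\<^sup>+v. P u v \<partial>lborel \<partial>lborel)"
    unfolding P_def by (simp add: nn_integral_std_gaussian nn_integral_cmult)
  also have "\<dots> = (\<integral>\<^sup>+v. \<integral>\<^sup>+u. P u v \<partial>lborel \<partial>lborel)"
    by (rule lborel_pair.Fubini'[symmetric]) simp
  also have "\<dots> = (\<integral>\<^sup>+v. ennreal (\<bar>1 / a\<bar> ^ DIM('a)) * (\<integral>\<^sup>+x. P ((- b / a) *\<^sub>R v + (1 / a) *\<^sub>R x) v \<partial>lborel) \<partial>lborel)"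
    using \<open>a \<noteq> 0\<close> by (intro nn_integral_cong nn_integral_lborel_affine) auto
  also have "\<dots> = ennreal (\<bar>1 / a\<bar> ^ DIM('a)) * (\<integral>\<^sup>+v. (\<integral>\<^sup>+x. P ((- b / a) *\<^sub>R v + (1 / a) *\<^sub>R x) v \<partial>lborel) \<partial>lborel)"
    by (rule nn_integral_cmult) measurable
  also have "(\<integral>\<^sup>+v. (\<integral>\<^sup>+x. P ((- b / a) *\<^sub>R v + (1 / a) *\<^sub>R x) v \<partial>lborel) \<partial>lborel) =
     (\<integral>\<^sup>+x. (\<integral>\<^sup>+v. P ((- b / a) *\<^sub>R v + (1 / a) *\<^sub>R x) v \<partial>lborel) \<partial>lborel)"
    by (rule lborel_pair.Fubini') measurable
  also have "\<dots> = (\<integral>\<^sup>+x. ennreal (\<bar>a\<bar> ^ DIM('a)) *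
       (\<integral>\<^sup>+y. P ((- b / a) *\<^sub>R (b *\<^sub>R x + a *\<^sub>R y) + (1 / a) *\<^sub>R x) (b *\<^sub>R x + a *\<^sub>R y) \<partial>lborel) \<partial>lborel)"
    using \<open>a \<noteq> 0\<close> by (intro nn_integral_cong nn_integral_lborel_affine) auto
  also have "\<dots> = ennreal (\<bar>a\<bar> ^ DIM('a)) * (\<integral>\<^sup>+x.
       (\<integral>\<^sup>+y. P ((- b / a) *\<^sub>R (b *\<^sub>R x + a *\<^sub>R y) + (1 / a) *\<^sub>R x) (b *\<^sub>R x + a *\<^sub>R y) \<partial>lborel) \<partial>lborel)"
    by (rule nn_integral_cmult) measurable
  also have "ennreal (\<bar>1 / a\<bar> ^ DIM('a)) * \<dots> = (\<integral>\<^sup>+x.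
       (\<integral>\<^sup>+y. P ((- b / a) *\<^sub>R (b *\<^sub>R x + a *\<^sub>R y) + (1 / a) *\<^sub>R x) (b *\<^sub>R x + a *\<^sub>R y) \<partial>lborel) \<partial>lborel)"
    using \<open>a \<noteq> 0\<close>
    by (simp add: mult.assoc[symmetric] ennreal_mult[symmetric] power_mult_distrib[symmetric] abs_mult[symmetric])
  also have "\<dots> = (\<integral>\<^sup>+x. (\<integral>\<^sup>+y. P (a *\<^sub>R x - b *\<^sub>R y) (b *\<^sub>R x + a *\<^sub>R y) \<partial>lborel) \<partial>lborel)"
  proof -
    have "(- b / a) *\<^sub>R (b *\<^sub>R x + a *\<^sub>R y) + (1 / a) *\<^sub>R x = a *\<^sub>R x - b *\<^sub>R y" for x y :: 'a
    proof -
      have "1 / a = a + b * b / a"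
        using ab \<open>a \<noteq> 0\<close> by (simp add: field_simps power2_eq_square)
      then have "(1 / a) *\<^sub>R x = a *\<^sub>R x + (b * b / a) *\<^sub>R x"
        by (metis scaleR_left_distrib)
      then show ?thesis
        using \<open>a \<noteq> 0\<close> by (simp add: scaleR_add_right)
    qed
    then show ?thesis by simp
  qed
  also have "\<dots> = (\<integral>\<^sup>+x. \<integral>\<^sup>+y. F (a *\<^sub>R x - b *\<^sub>R y) (b *\<^sub>R x + a *\<^sub>R y) \<partial>std_gaussian \<partial>std_gaussian)"
  proof -
    have "P (a *\<^sub>R x - b *\<^sub>R y) (b *\<^sub>R x + a *\<^sub>R y) = ennreal (std_gaussian_density x) *
       (ennreal (std_gaussian_density y) * F (a *\<^sub>R x - b *\<^sub>R y) (b *\<^sub>R x + a *\<^sub>R y))" for x y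
      unfolding P_def mult.assoc[symmetric]
      by (simp only: ennreal_mult[symmetric] std_gaussian_density_nonneg density[of x y])
    then show ?thesis
      by (simp add: nn_integral_std_gaussian nn_integral_cmult)
  qed
  finally show ?thesis ..
qed

section \<open>Projections onto a line\<close>

text \<open>Expanded in the basis, \<open>x \<bullet> n\<close> is a sum of independent centred
  normals with standard deviations \<open>\<bar>n \<bullet> b\<bar>\<close>, whose squares add up to
  the squared norm of \<open>n\<close>.\<close>

lemma distributed_std_gaussian_inner:
  fixes n :: "'a::euclidean_space"
  assumes "n \<noteq> 0"
  shows "distributed std_gaussian lborel (\<lambda>x. x \<bullet> n) (normal_density 0 (norm n))"
proof -
  let ?N = "density lborel (\<lambda>x. ennreal (std_normal_density x))"
  interpret N: prob_space ?N by (rule prob_space_normal_density) simp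
  have coord: "distr (std_gaussian :: 'a measure) borel (\<lambda>x. x \<bullet> b) = ?N" if b: "b \<in> Basis" for b
  proof (rule measure_eqI)
    fix A assume "A \<in> sets (distr (std_gaussian :: 'a measure) borel (\<lambda>x. x \<bullet> b))"
    then have [measurable]: "A \<in> sets borel" by simp
    have "emeasure (distr (std_gaussian :: 'a measure) borel (\<lambda>x. x \<bullet> b)) A =
       emeasure std_gaussian {x::'a. \<forall>c\<in>Basis. x \<bullet> c \<in> (if c = b then A else UNIV)}"
      using b by (subst emeasure_distr) (auto intro!: arg_cong[where f="emeasure _"] split: if_splits)
    also have "\<dots> = (\<Prod>c\<in>Basis. emeasure ?N (if c = b then A else UNIV))"
      by (rule emeasure_std_gaussian_box) auto
    also have "\<dots> = (\<Prod>c\<in>Basis. if c = b then emeasure ?N A else 1)"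
      using N.emeasure_space_1 by (intro prod.cong) auto
    also have "\<dots> = emeasure ?N A" using b by (simp add: prod.delta)
    finally show "emeasure (distr (std_gaussian :: 'a measure) borel (\<lambda>x. x \<bullet> b)) A = emeasure ?N A" .
  qed simp
  have indep: "std_gaussian.indep_vars (\<lambda>_. borel) (\<lambda>b x. x \<bullet> b) (Basis :: 'a set)"
  proof (subst std_gaussian.indep_vars_iff_distr_eq_PiM)
    interpret P: product_sigma_finite "\<lambda>b::'a. distr (std_gaussian :: 'a measure) borel (\<lambda>x. x \<bullet> b)"
      by (intro product_sigma_finite.intro prob_space_imp_sigma_finite std_gaussian.prob_space_distr) simp
    show "distr std_gaussian (Pi\<^sub>M Basis (\<lambda>_. borel)) (\<lambda>x. \<lambda>b\<in>Basis. x \<bullet> b) =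
      Pi\<^sub>M Basis (\<lambda>b::'a. distr std_gaussian borel (\<lambda>x. x \<bullet> b))"
    proof (rule P.PiM_eqI)
      fix A assume A: "\<And>b::'a. b \<in> Basis \<Longrightarrow> A b \<in> sets (distr (std_gaussian :: 'a measure) borel (\<lambda>x. x \<bullet> b))"
      have "emeasure (distr std_gaussian (Pi\<^sub>M Basis (\<lambda>_. borel)) (\<lambda>x::'a. \<lambda>b\<in>Basis. x \<bullet> b)) (Pi\<^sub>E Basis A) =
         emeasure std_gaussian {x::'a. \<forall>b\<in>Basis. x \<bullet> b \<in> A b}"
        using A by (subst emeasure_distr)
          (auto intro!: sets_PiM_I_finite arg_cong[where f="emeasure _"] simp: PiE_iff)
      also have "\<dots> = (\<Prod>b\<in>Basis. emeasure ?N (A b))"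
        using A by (intro emeasure_std_gaussian_box) auto
      also have "\<dots> = (\<Prod>b\<in>Basis. emeasure (distr (std_gaussian :: 'a measure) borel (\<lambda>x. x \<bullet> b)) (A b))"
        by (simp add: coord)
      finally show "emeasure (distr std_gaussian (Pi\<^sub>M Basis (\<lambda>_. borel)) (\<lambda>x::'a. \<lambda>b\<in>Basis. x \<bullet> b)) (Pi\<^sub>E Basis A) =
        (\<Prod>b\<in>Basis. emeasure (distr (std_gaussian :: 'a measure) borel (\<lambda>x. x \<bullet> b)) (A b))" .
    qed (auto intro!: sets_PiM_cong)
  qed auto
  \<comment> \<open>Summands with \<open>n \<bullet> b = 0\<close> are constant, and the theorem on
    sums of independent normals asks for positive standard deviations and a nonempty index
    set.\<close>
  let ?B = "{b \<in> Basis. n \<bullet> b \<noteq> 0}"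
  have "?B \<noteq> {}" using assms euclidean_all_zero_iff[of n] by auto
  have sum_B: "(\<Sum>b\<in>?B. f b * (n \<bullet> b)) = (\<Sum>b\<in>Basis. f b * (n \<bullet> b))" for f :: "'a \<Rightarrow> real"
    by (rule sum.mono_neutral_left) auto
  have "distributed std_gaussian lborel (\<lambda>x. \<Sum>b\<in>?B. (x \<bullet> b) * (n \<bullet> b))
     (normal_density (\<Sum>b\<in>?B. 0) (sqrt (\<Sum>b\<in>?B. \<bar>n \<bullet> b\<bar>\<^sup>2)))"
  proof (rule std_gaussian.sum_indep_normal)
    show "std_gaussian.indep_vars (\<lambda>_. borel) (\<lambda>b x. (x \<bullet> b) * (n \<bullet> b)) ?B"
      using std_gaussian.indep_vars_compose2[OF std_gaussian.indep_vars_subset[OF indep], of ?B "\<lambda>b x. x * (n \<bullet> b)" "\<lambda>_. borel"]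
      by auto
    fix b assume b: "b \<in> ?B"
    have "distributed std_gaussian lborel (\<lambda>x. x \<bullet> b) (normal_density 0 1)"
      using b coord[of b] by (auto simp: distributed_def cong: distr_cong)
    from std_gaussian.normal_density_affine[OF this, of "n \<bullet> b" 0] b
    show "distributed std_gaussian lborel (\<lambda>x. (x \<bullet> b) * (n \<bullet> b)) (normal_density 0 \<bar>n \<bullet> b\<bar>)"
      by (simp add: mult.commute)
  qed (use \<open>?B \<noteq> {}\<close> in auto)
  moreover have "sqrt (\<Sum>b\<in>?B. \<bar>n \<bullet> b\<bar>\<^sup>2) = norm n"
    using sum_B[of "\<lambda>b. n \<bullet> b"] by (simp add: norm_eq_sqrt_inner euclidean_inner[of n n] power2_eq_square)
  moreover have "(\<lambda>x. \<Sum>b\<in>?B. (x \<bullet> b) * (n \<bullet> b)) = (\<lambda>x. x \<bullet> n)"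
    using sum_B by (simp add: euclidean_inner[of _ n] fun_eq_iff)
  ultimately show ?thesis by simp
qed

lemma nn_integral_std_gaussian_inner:
  fixes n :: "'a::euclidean_space"
  assumes "n \<noteq> 0" and [measurable]: "f \<in> borel_measurable borel"
  shows "(\<integral>\<^sup>+x. f (x \<bullet> n) \<partial>std_gaussian) = (\<integral>\<^sup>+y. f (norm n * y) \<partial>(std_gaussian :: real measure))"
proof -
  have "distributed (std_gaussian :: real measure) lborel (\<lambda>x. x) (normal_density 0 1)"
    unfolding distributed_def std_gaussian_def std_gaussian_density_real
    by (auto intro!: measure_eqI simp: emeasure_distr)
  from std_gaussian.normal_density_affine[OF this, of "norm n" 0] assms(1)
  have "distr (std_gaussian :: real measure) lborel (\<lambda>y. norm n * y) = density lborel (normal_density 0 (norm n))"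
    by (simp add: distributed_def)
  moreover have "distr (std_gaussian :: 'a measure) lborel (\<lambda>x. x \<bullet> n) = density lborel (normal_density 0 (norm n))"
    using distributed_std_gaussian_inner[OF assms(1)] by (simp add: distributed_def)
  ultimately have "(\<integral>\<^sup>+y. f y \<partial>distr (std_gaussian :: 'a measure) lborel (\<lambda>x. x \<bullet> n)) =
      (\<integral>\<^sup>+y. f y \<partial>distr (std_gaussian :: real measure) lborel (\<lambda>y. norm n * y))" by simp
  then show ?thesis by (simp add: nn_integral_distr)
qed

section \<open>The plane through three Gaussian points\<close>

text \<open>The first absolute moment \<open>sqrt (2 / pi)\<close> of the standard normal, rescaled:
  one factor \<open>c\<close> comes from the Jacobian and one from \<open>\<bar>c * p\<bar>\<close>.
  It is the radial integral in the computation of a wedge.\<close>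

lemma nn_integral_abs_std_normal_density_scale:
  assumes "0 < c"
  shows "(\<integral>\<^sup>+p. ennreal (\<bar>p\<bar> * std_normal_density (c * p)) \<partial>lborel) = ennreal (sqrt (2 / pi) / c\<^sup>2)"
proof -
  have "has_bochner_integral lborel (\<lambda>x. std_normal_density x * \<bar>x\<bar>) (sqrt (2 / pi))"
    using std_normal_moment_abs_odd[of 0] by simp
  then have "ennreal (sqrt (2 / pi)) = (\<integral>\<^sup>+x. ennreal (std_normal_density x * \<bar>x\<bar>) \<partial>lborel)"
    by (subst nn_integral_eq_integral) (auto simp: has_bochner_integral_iff)
  also have "\<dots> = ennreal c * (\<integral>\<^sup>+p. ennreal (std_normal_density (c * p) * \<bar>c * p\<bar>) \<partial>lborel)"
    using assms by (subst nn_integral_real_affine[of _ c 0]) auto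
  also have "\<dots> = ennreal (c\<^sup>2) * (\<integral>\<^sup>+p. ennreal (\<bar>p\<bar> * std_normal_density (c * p)) \<partial>lborel)"
    using assms
    by (simp add: nn_integral_cmult[symmetric] ennreal_mult'[symmetric] abs_mult power2_eq_square mult_ac)
  finally have "ennreal (1 / c\<^sup>2) * ennreal (sqrt (2 / pi)) =
     (ennreal (1 / c\<^sup>2) * ennreal (c\<^sup>2)) * (\<integral>\<^sup>+p. ennreal (\<bar>p\<bar> * std_normal_density (c * p)) \<partial>lborel)"
    by (simp add: mult.assoc)
  then show ?thesis
    using assms by (simp add: ennreal_mult[symmetric])
qed

text \<open>The event \<open>\<bar>r\<bar> \<le> k * \<bar>p\<bar>\<close> is a double wedge of
  total angle 4 arctan \<open>k\<close>, and the planar Gaussian gives it the fraction of the full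
  angle 2 \<pi>. Instead of polar coordinates the slope \<open>t = r / p\<close> serves as the
  angular variable.\<close>

lemma std_gaussian_wedge:
  assumes "0 \<le> k"
  shows "(\<integral>\<^sup>+r. \<integral>\<^sup>+p. indicator {x. x \<le> 0} (r\<^sup>2 - k\<^sup>2 * p\<^sup>2) \<partial>std_gaussian \<partial>std_gaussian) =
    ennreal (2 / pi * arctan k)"
proof -
  let ?\<phi> = std_normal_density and ?I = "\<lambda>x::real. indicator {x. x \<le> 0} x :: ennreal"
  have "(\<integral>\<^sup>+r. \<integral>\<^sup>+p. ?I (r\<^sup>2 - k\<^sup>2 * p\<^sup>2) \<partial>std_gaussian \<partial>std_gaussian) =
      (\<integral>\<^sup>+p. \<integral>\<^sup>+r. ?I (r\<^sup>2 - k\<^sup>2 * p\<^sup>2) \<partial>std_gaussian \<partial>std_gaussian)"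
    by (rule std_gaussian_pair.Fubini'[symmetric]) measurable
  also have "\<dots> = (\<integral>\<^sup>+p. ?\<phi> p * (\<integral>\<^sup>+r. ?\<phi> r * ?I (r\<^sup>2 - k\<^sup>2 * p\<^sup>2) \<partial>lborel) \<partial>lborel)"
    by (simp add: nn_integral_std_gaussian std_gaussian_density_real)
  \<comment> \<open>Substitution \<open>r = p * t\<close> with Jacobian
    \<open>\<bar>p\<bar>\<close>, legitimate only for \<open>p \<noteq> 0\<close>, hence an
    almost-everywhere comparison. The event becomes \<open>\<bar>t\<bar> \<le> k\<close>, free of
    \<open>p\<close>.\<close>
  also have "\<dots> = (\<integral>\<^sup>+p. \<integral>\<^sup>+t. ennreal (1 / sqrt (2 * pi)) * indicator {-k..k} t *
      ennreal (\<bar>p\<bar> * ?\<phi> (sqrt (1 + t\<^sup>2) * p)) \<partial>lborel \<partial>lborel)"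
  proof (rule nn_integral_cong_AE)
    have *: "?\<phi> p * ?\<phi> (p * t) = 1 / sqrt (2 * pi) * ?\<phi> (sqrt (1 + t\<^sup>2) * p)" for p t
      by (simp add: std_normal_density_def power_mult_distrib exp_add[symmetric] field_simps)
    have "?\<phi> p * (\<integral>\<^sup>+r. ?\<phi> r * ?I (r\<^sup>2 - k\<^sup>2 * p\<^sup>2) \<partial>lborel) =
      (\<integral>\<^sup>+t. ennreal (1 / sqrt (2 * pi)) * indicator {-k..k} t *
      ennreal (\<bar>p\<bar> * ?\<phi> (sqrt (1 + t\<^sup>2) * p)) \<partial>lborel)" if "p \<noteq> 0" for p
    proof -
      have I: "?I ((p * t)\<^sup>2 - k\<^sup>2 * p\<^sup>2) = indicator {-k..k} t" for t
      proof -
        have "(p * t)\<^sup>2 - k\<^sup>2 * p\<^sup>2 \<le> 0 \<longleftrightarrow> t\<^sup>2 \<le> k\<^sup>2"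
          using that by (simp add: power_mult_distrib)
        also have "\<dots> \<longleftrightarrow> \<bar>t\<bar> \<le> k"
          using assms by (metis abs_le_square_iff abs_of_nonneg)
        finally show ?thesis by (auto simp: indicator_def abs_le_iff)
      qed
      have "(\<integral>\<^sup>+r. ?\<phi> r * ?I (r\<^sup>2 - k\<^sup>2 * p\<^sup>2) \<partial>lborel) =
         ennreal \<bar>p\<bar> * (\<integral>\<^sup>+t. ?\<phi> (p * t) * ?I ((p * t)\<^sup>2 - k\<^sup>2 * p\<^sup>2) \<partial>lborel)"
        using that by (subst nn_integral_real_affine[of _ p 0]) auto
      then have "?\<phi> p * (\<integral>\<^sup>+r. ?\<phi> r * ?I (r\<^sup>2 - k\<^sup>2 * p\<^sup>2) \<partial>lborel) =
         (\<integral>\<^sup>+t. ennreal (?\<phi> p) * (ennreal \<bar>p\<bar> * (ennreal (?\<phi> (p * t)) * indicator {-k..k} t)) \<partial>lborel)"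
        unfolding I by (simp add: nn_integral_cmult)
      also have "\<dots> = (\<integral>\<^sup>+t. ennreal (1 / sqrt (2 * pi)) * indicator {-k..k} t *
        ennreal (\<bar>p\<bar> * ?\<phi> (sqrt (1 + t\<^sup>2) * p)) \<partial>lborel)"
      proof (rule nn_integral_cong)
        fix t
        have "ennreal (?\<phi> p) * (ennreal \<bar>p\<bar> * (ennreal (?\<phi> (p * t)) * indicator {-k..k} t)) =
          ennreal (\<bar>p\<bar> * (?\<phi> p * ?\<phi> (p * t))) * indicator {-k..k} t"
          by (simp add: ennreal_mult mult_ac)
        then show "ennreal (?\<phi> p) * (ennreal \<bar>p\<bar> * (ennreal (?\<phi> (p * t)) * indicator {-k..k} t)) =
          ennreal (1 / sqrt (2 * pi)) * indicator {-k..k} t * ennreal (\<bar>p\<bar> * ?\<phi> (sqrt (1 + t\<^sup>2) * p))"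
          unfolding * by (simp add: ennreal_mult'[symmetric] mult_ac del: real_sqrt_mult)
      qed
      finally show ?thesis .
    qed
    note eq = this
    show "AE p in lborel. ?\<phi> p * (\<integral>\<^sup>+r. ?\<phi> r * ?I (r\<^sup>2 - k\<^sup>2 * p\<^sup>2) \<partial>lborel) =
      (\<integral>\<^sup>+t. ennreal (1 / sqrt (2 * pi)) * indicator {-k..k} t *
      ennreal (\<bar>p\<bar> * ?\<phi> (sqrt (1 + t\<^sup>2) * p)) \<partial>lborel)"
      using AE_lborel_singleton[of "0::real"] by eventually_elim (rule eq)
  qed
  also have "\<dots> = (\<integral>\<^sup>+t. \<integral>\<^sup>+p. ennreal (1 / sqrt (2 * pi)) * indicator {-k..k} t *
      ennreal (\<bar>p\<bar> * ?\<phi> (sqrt (1 + t\<^sup>2) * p)) \<partial>lborel \<partial>lborel)"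
    by (rule lborel_pair.Fubini') measurable
  \<comment> \<open>Integrating out \<open>p\<close> leaves the Cauchy density, the law of the ratio
    of two standard normals; its primitive is \<open>arctan t / pi\<close>.\<close>
  also have "\<dots> = (\<integral>\<^sup>+t. ennreal (1 / (pi * (1 + t\<^sup>2))) * indicator {-k..k} t \<partial>lborel)"
  proof (rule nn_integral_cong)
    fix t :: real
    have pos: "0 < 1 + t\<^sup>2" by (simp add: add_pos_nonneg)
    have "(\<integral>\<^sup>+p. ennreal (1 / sqrt (2 * pi)) * indicator {-k..k} t *
        ennreal (\<bar>p\<bar> * ?\<phi> (sqrt (1 + t\<^sup>2) * p)) \<partial>lborel) =
      ennreal (1 / sqrt (2 * pi)) * indicator {-k..k} t * ennreal (sqrt (2 / pi) / (sqrt (1 + t\<^sup>2))\<^sup>2)"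
      using pos by (subst nn_integral_cmult) (auto simp: nn_integral_abs_std_normal_density_scale)
    also have "\<dots> = ennreal (1 / sqrt (2 * pi) * (sqrt (2 / pi) / (1 + t\<^sup>2))) * indicator {-k..k} t"
      using pos by (subst ennreal_mult) (auto simp: mult_ac)
    also have "1 / sqrt (2 * pi) * (sqrt (2 / pi) / (1 + t\<^sup>2)) = 1 / (pi * (1 + t\<^sup>2))"
      by (simp add: real_sqrt_mult real_sqrt_divide)
    finally show "(\<integral>\<^sup>+p. ennreal (1 / sqrt (2 * pi)) * indicator {-k..k} t *
        ennreal (\<bar>p\<bar> * ?\<phi> (sqrt (1 + t\<^sup>2) * p)) \<partial>lborel) =
      ennreal (1 / (pi * (1 + t\<^sup>2))) * indicator {-k..k} t" .
  qed
  also have "\<dots> = ennreal (arctan k / pi - arctan (-k) / pi)"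
  proof (rule nn_integral_FTC_Icc)
    fix t :: real
    have "1 / (pi * (1 + t\<^sup>2)) = inverse (1 + t\<^sup>2) / pi" by (simp add: divide_inverse)
    then show "((\<lambda>t. arctan t / pi) has_real_derivative 1 / (pi * (1 + t\<^sup>2))) (at t)"
      using DERIV_cdivide[OF DERIV_arctan, of pi t] by simp
    show "0 \<le> 1 / (pi * (1 + t\<^sup>2))" by simp
  qed (use assms in auto)
  also have "\<dots> = ennreal (2 / pi * arctan k)"
    by (simp add: arctan_minus)
  finally show ?thesis .
qed

text \<open>The product (x - tz)(y - tz) is a difference of squares: rotating \<open>(x, y)\<close>
  by 45 degrees turns it into half of (x - sqrt 2 t z)^2 - y^2. The first square has a base of
  variance \<open>c\<^sup>2 = 1 + 2 * t\<^sup>2\<close>, so the event is a wedge of slope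
  \<open>1 / c\<close>.\<close>

lemma std_gaussian_orthant:
  fixes t :: real
  shows "(\<integral>\<^sup>+z. \<integral>\<^sup>+x. \<integral>\<^sup>+y. indicator {x. x \<le> 0} ((x - t * z) * (y - t * z))
      \<partial>std_gaussian \<partial>std_gaussian \<partial>std_gaussian) = ennreal (2 / pi * arctan (1 / sqrt (1 + 2 * t\<^sup>2)))"
proof -
  let ?I = "\<lambda>x::real. indicator {x. x \<le> 0} x :: ennreal"
  define c where "c = sqrt (1 + 2 * t\<^sup>2)"
  have c2: "c\<^sup>2 = 1 + 2 * t\<^sup>2" by (simp add: c_def)
  have "c > 0" by (simp add: c_def add_pos_nonneg)
  have "(\<integral>\<^sup>+z. \<integral>\<^sup>+x. \<integral>\<^sup>+y. ?I ((x - t * z) * (y - t * z)) \<partial>std_gaussian \<partial>std_gaussian \<partial>std_gaussian) =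
    (\<integral>\<^sup>+z. \<integral>\<^sup>+x. \<integral>\<^sup>+y. ?I (((1 / sqrt 2) *\<^sub>R x - (1 / sqrt 2) *\<^sub>R y - t * z) * ((1 / sqrt 2) *\<^sub>R x + (1 / sqrt 2) *\<^sub>R y - t * z))
       \<partial>std_gaussian \<partial>std_gaussian \<partial>std_gaussian)"
    by (intro nn_integral_cong nn_integral_std_gaussian_rotate[symmetric]) (auto simp: power_divide)
  also have "\<dots> = (\<integral>\<^sup>+z. \<integral>\<^sup>+x. \<integral>\<^sup>+y. ?I (c\<^sup>2 * ((- sqrt 2 * t / c) *\<^sub>R z + (1 / c) *\<^sub>R x)\<^sup>2 - y\<^sup>2)
       \<partial>std_gaussian \<partial>std_gaussian \<partial>std_gaussian)"
  proof -
    have "(1 / sqrt 2 * x - 1 / sqrt 2 * y - t * z) * (1 / sqrt 2 * x + 1 / sqrt 2 * y - t * z) =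
      (c\<^sup>2 * (- sqrt 2 * t / c * z + 1 / c * x)\<^sup>2 - y\<^sup>2) / 2" for x y z
    proof -
      have "c\<^sup>2 * (- sqrt 2 * t / c * z + 1 / c * x)\<^sup>2 = (x - sqrt 2 * t * z)\<^sup>2"
        using \<open>c > 0\<close> by (simp add: power_mult_distrib[symmetric] field_simps)
      note eq = this
      have "(1 / sqrt 2 * x - 1 / sqrt 2 * y - t * z) * (1 / sqrt 2 * x + 1 / sqrt 2 * y - t * z) =
        (x / sqrt 2 - t * z)\<^sup>2 - (y / sqrt 2)\<^sup>2"
        by (simp add: power2_eq_square algebra_simps)
      moreover have "x / sqrt 2 - t * z = (x - sqrt 2 * t * z) / sqrt 2"
        by (simp add: field_simps)
      ultimately have "(1 / sqrt 2 * x - 1 / sqrt 2 * y - t * z) * (1 / sqrt 2 * x + 1 / sqrt 2 * y - t * z) =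
        ((x - sqrt 2 * t * z) / sqrt 2)\<^sup>2 - (y / sqrt 2)\<^sup>2"
        by (simp only:)
      also have "\<dots> = ((x - sqrt 2 * t * z)\<^sup>2 - y\<^sup>2) / 2"
        unfolding power_divide by (simp add: diff_divide_distrib[symmetric])
      finally show ?thesis by (simp only: eq)
    qed
    moreover have "?I (u / 2) = ?I u" for u
      by (simp add: indicator_def)
    ultimately show ?thesis by (simp only: real_scaleR_def)
  qed
  \<comment> \<open>Here cosine \<open>1 / c\<close> and sine \<open>- sqrt 2 * t / c\<close> rotate
    \<open>(z, x)\<close> so that the combination inside the square becomes a single standard
    normal; the other rotated variable no longer occurs and integrates to 1.\<close>
  also have "\<dots> = (\<integral>\<^sup>+z. \<integral>\<^sup>+x. \<integral>\<^sup>+y. ?I (c\<^sup>2 * x\<^sup>2 - y\<^sup>2)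
       \<partial>std_gaussian \<partial>std_gaussian \<partial>(std_gaussian :: real measure))"
  proof -
    have "(1 / c)\<^sup>2 + (- sqrt 2 * t / c)\<^sup>2 = c\<^sup>2 / c\<^sup>2"
      unfolding c2 by (simp add: power_divide power_mult_distrib c2 flip: add_divide_distrib)
    then have "(1 / c)\<^sup>2 + (- sqrt 2 * t / c)\<^sup>2 = 1"
      using \<open>c > 0\<close> by simp
    from nn_integral_std_gaussian_rotate[of "\<lambda>z x. \<integral>\<^sup>+y. ?I (c\<^sup>2 * x\<^sup>2 - y\<^sup>2) \<partial>std_gaussian", OF _ this]
    show ?thesis using \<open>c > 0\<close> by simp
  qed
  also have "\<dots> = (\<integral>\<^sup>+x. \<integral>\<^sup>+y. ?I (c\<^sup>2 * x\<^sup>2 - y\<^sup>2) \<partial>std_gaussian \<partial>std_gaussian)"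
    by (simp add: std_gaussian.emeasure_space_1[simplified])
  also have "\<dots> = (\<integral>\<^sup>+x. \<integral>\<^sup>+y. ?I (x\<^sup>2 - (1 / c)\<^sup>2 * y\<^sup>2) \<partial>std_gaussian \<partial>std_gaussian)"
  proof -
    have "c\<^sup>2 * x\<^sup>2 - y\<^sup>2 \<le> 0 \<longleftrightarrow> x\<^sup>2 - (1 / c)\<^sup>2 * y\<^sup>2 \<le> 0" for x y
      using \<open>c > 0\<close> by (simp add: field_simps)
    then show ?thesis by (simp add: indicator_def)
  qed
  also have "\<dots> = ennreal (2 / pi * arctan (1 / c))"
    using \<open>c > 0\<close> by (intro std_gaussian_wedge) simp
  finally show ?thesis by (simp add: c_def)
qed

text \<open>Only the three projections onto \<open>n\<close> matter; each is \<open>norm n\<close>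
  times a standard real normal, and the common factor does not change the sign of the product. The
  value is the same for every \<open>n\<close>, which is why the normal may afterwards be
  random.\<close>

lemma std_gaussian_opposite_sides:
  fixes n :: "'a::euclidean_space"
  assumes "n \<noteq> 0"
  shows "(\<integral>\<^sup>+p. \<integral>\<^sup>+x. \<integral>\<^sup>+y. indicator {x. x \<le> 0} ((x \<bullet> n - t * (p \<bullet> n)) * (y \<bullet> n - t * (p \<bullet> n)))
      \<partial>std_gaussian \<partial>std_gaussian \<partial>std_gaussian) = ennreal (2 / pi * arctan (1 / sqrt (1 + 2 * t\<^sup>2)))"
proof -
  let ?I = "\<lambda>x::real. indicator {x. x \<le> 0} x :: ennreal"
  have "(\<integral>\<^sup>+p. \<integral>\<^sup>+x. \<integral>\<^sup>+y. ?I ((x \<bullet> n - t * (p \<bullet> n)) * (y \<bullet> n - t * (p \<bullet> n))) \<partial>std_gaussian \<partial>std_gaussian \<partial>std_gaussian) =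
    (\<integral>\<^sup>+p. \<integral>\<^sup>+x. \<integral>\<^sup>+y. ?I ((x \<bullet> n - t * (p \<bullet> n)) * (norm n * y - t * (p \<bullet> n))) \<partial>std_gaussian \<partial>std_gaussian \<partial>std_gaussian)"
    by (intro nn_integral_cong nn_integral_std_gaussian_inner assms) measurable
  also have "\<dots> =
    (\<integral>\<^sup>+p. \<integral>\<^sup>+x. \<integral>\<^sup>+y. ?I ((norm n * x - t * (p \<bullet> n)) * (norm n * y - t * (p \<bullet> n))) \<partial>std_gaussian \<partial>std_gaussian \<partial>std_gaussian)"
    by (intro nn_integral_cong nn_integral_std_gaussian_inner[where f="\<lambda>x. \<integral>\<^sup>+y. ?I ((x - t * _) * (norm n * y - t * _)) \<partial>std_gaussian"] assms) measurable
  also have "\<dots> =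
    (\<integral>\<^sup>+p. \<integral>\<^sup>+x. \<integral>\<^sup>+y. ?I ((norm n * x - t * (norm n * p)) * (norm n * y - t * (norm n * p))) \<partial>std_gaussian \<partial>std_gaussian \<partial>std_gaussian)"
    by (intro nn_integral_std_gaussian_inner[where f="\<lambda>p. \<integral>\<^sup>+x. \<integral>\<^sup>+y. ?I ((norm n * x - t * p) * (norm n * y - t * p)) \<partial>std_gaussian \<partial>std_gaussian"] assms) measurable
  also have "\<dots> = (\<integral>\<^sup>+p. \<integral>\<^sup>+x. \<integral>\<^sup>+y. ?I ((x - t * p) * (y - t * p)) \<partial>std_gaussian \<partial>std_gaussian \<partial>std_gaussian)"
  proof -
    have "(norm n * x - t * (norm n * p)) * (norm n * y - t * (norm n * p)) = (norm n)\<^sup>2 * ((x - t * p) * (y - t * p))" for x y p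
      by (simp add: power2_eq_square algebra_simps)
    moreover have "(norm n)\<^sup>2 * u \<le> 0 \<longleftrightarrow> u \<le> 0" for u
      using assms by (simp add: mult_le_0_iff)
    ultimately show ?thesis by (simp add: indicator_def)
  qed
  finally show ?thesis by (simp add: std_gaussian_orthant)
qed

section \<open>Degenerate positions are null\<close>

lemma AE_std_gaussian_not_hyperplane:
  fixes a :: "'a::euclidean_space"
  assumes "a \<noteq> 0"
  shows "AE x in std_gaussian. a \<bullet> x \<noteq> b"
proof -
  have "{x. a \<bullet> x = b} \<in> null_sets lebesgue"
    using assms negligible_hyperplane[of a b] by (simp add: negligible_iff_null_sets)
  then have "{x. a \<bullet> x = b} \<in> null_sets lborel"
    by (simp add: null_sets_completion_iff)
  then have "AE x in lborel. a \<bullet> x \<noteq> b"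
    by (auto dest: AE_not_in)
  then show ?thesis
    unfolding std_gaussian_def by (subst AE_density) auto
qed

lemma AE_std_gaussian_neq: "AE x in std_gaussian. x \<noteq> (c::'a::euclidean_space)"
proof -
  obtain b :: 'a where "b \<in> Basis" using nonempty_Basis by blast
  then have "b \<noteq> 0" by auto
  from AE_std_gaussian_not_hyperplane[OF this, of "b \<bullet> c"] show ?thesis
    by eventually_elim auto
qed

lemma measurable_cross3 [measurable (raw)]:
  assumes [measurable]: "f \<in> borel_measurable M" "g \<in> borel_measurable M"
  shows "(\<lambda>x. cross3 (f x) (g x)) \<in> borel_measurable M"
  by (rule borel_measurable_continuous_Pair)
     (auto intro!: continuous_on_cross continuous_intros)

text \<open>Collinearity is reduced to a hyperplane: for \<open>b\<close> not parallel to
  \<open>a\<close>, the triple product turns the equation \<open>cross3 a (w - c) = 0\<close> into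
  \<open>w\<close> lying on a plane with normal \<open>cross3 b a\<close>.\<close>

lemma AE_std_gaussian_cross3:
  assumes "a \<noteq> 0"
  shows "AE w in std_gaussian. cross3 a (w - c) \<noteq> 0"
proof -
  obtain b where b: "cross3 b a \<noteq> 0"
    using assms cross_basis_nonzero[of a] by (metis cross_skew neg_equal_0_iff_equal)
  have "AE w in std_gaussian. cross3 b a \<bullet> w \<noteq> cross3 b a \<bullet> c"
    by (rule AE_std_gaussian_not_hyperplane[OF b])
  then show ?thesis
  proof eventually_elim
    case (elim w)
    have "b \<bullet> cross3 a (w - c) = cross3 b a \<bullet> (w - c)"
      by (metis cross_triple inner_commute)
    with elim show ?case by (auto simp: inner_diff_right)
  qed
qed


text \<open>Two pairwise rotations, \<open>(c, d)\<close> to \<open>(u, v)\<close> and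
  \<open>(u, e)\<close> to \<open>(p, w)\<close>, build the three-point change of variables. The
  differences of \<open>c\<close>, \<open>d\<close>, \<open>e\<close> involve only \<open>v\<close>
  and \<open>w\<close>, the normal is \<open>sqrt 3 *\<^sub>R cross3 v w\<close>, and
  \<open>p\<close> enters only through the offset of the plane. With \<open>t = 1 / sqrt 3\<close>
  the fixed-normal value is arctan of \<open>1 / sqrt (5 / 3)\<close>.\<close>

lemma std_gaussian_opposite_sides_random_plane:
  "(\<integral>\<^sup>+c. \<integral>\<^sup>+d. \<integral>\<^sup>+e. \<integral>\<^sup>+x. \<integral>\<^sup>+y.
      indicator {x. x \<le> 0} (((x - c) \<bullet> cross3 (d - c) (e - c)) * ((y - c) \<bullet> cross3 (d - c) (e - c)))
      \<partial>std_gaussian \<partial>std_gaussian \<partial>std_gaussian \<partial>std_gaussian \<partial>std_gaussian) =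
    ennreal (2 / pi * arctan (sqrt (3 / 5)))"
proof -
  let ?G = "std_gaussian :: (real^3) measure" and ?I = "\<lambda>x::real. indicator {x. x \<le> 0} x :: ennreal"
  define W where "W c d e = (\<integral>\<^sup>+x. \<integral>\<^sup>+y.
      ?I (((x - c) \<bullet> cross3 (d - c) (e - c)) * ((y - c) \<bullet> cross3 (d - c) (e - c))) \<partial>?G \<partial>?G)" for c d e
  define V where "V p n = (\<integral>\<^sup>+x. \<integral>\<^sup>+y.
      ?I ((x \<bullet> n - (1 / sqrt 3) * (p \<bullet> n)) * (y \<bullet> n - (1 / sqrt 3) * (p \<bullet> n))) \<partial>?G \<partial>?G)" for p n
  have [measurable]: "(\<lambda>x. W (f x) (g x) (h x)) \<in> borel_measurable N"
    if [measurable]: "f \<in> borel_measurable N" "g \<in> borel_measurable N" "h \<in> borel_measurable N"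
    for f g h :: "'b \<Rightarrow> real^3" and N
    unfolding W_def by measurable
  have [measurable]: "(\<lambda>x. V (f x) (g x)) \<in> borel_measurable N"
    if [measurable]: "f \<in> borel_measurable N" "g \<in> borel_measurable N"
    for f g :: "'b \<Rightarrow> real^3" and N
    unfolding V_def by measurable
  let ?a = "1 / sqrt 2" and ?b = "sqrt 2 / sqrt 3" and ?c = "1 / sqrt 3"
  \<comment> \<open>\<open>c = p/sqrt 3 - w/sqrt 6 - v/sqrt 2\<close>, \<open>d = p/sqrt 3 - w/sqrt 6 + v/sqrt 2\<close>, \<open>e = (p + sqrt 2 w)/sqrt 3\<close>:
    an orthogonal change of variables in which \<open>p/sqrt 3\<close> is the centroid of \<open>c\<close>, \<open>d\<close>, \<open>e\<close>.\<close>
  have W_eq: "W (?a *\<^sub>R (?b *\<^sub>R p - ?c *\<^sub>R w) - ?a *\<^sub>R v) (?a *\<^sub>R (?b *\<^sub>R p - ?c *\<^sub>R w) + ?a *\<^sub>R v) (?c *\<^sub>R p + ?b *\<^sub>R w) =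
    V p (cross3 v w)" for p v w
  proof -
    let ?C = "?a *\<^sub>R (?b *\<^sub>R p - ?c *\<^sub>R w) - ?a *\<^sub>R v"
    have 1: "?a *\<^sub>R (?b *\<^sub>R p - ?c *\<^sub>R w) + ?a *\<^sub>R v - ?C = sqrt 2 *\<^sub>R v"
    proof -
      have "?a *\<^sub>R (?b *\<^sub>R p - ?c *\<^sub>R w) + ?a *\<^sub>R v - ?C = (2 * ?a) *\<^sub>R v"
        by (simp only: scaleR_left_distrib scaleR_2 flip: scaleR_scaleR) simp
      then show ?thesis by (simp add: real_div_sqrt)
    qed
    have 2: "?c *\<^sub>R p + ?b *\<^sub>R w - ?C = (sqrt 3 / sqrt 2) *\<^sub>R w + ?a *\<^sub>R v"
    proof -
      have "?a * ?b = ?c" "?b + ?a * ?c = sqrt 3 / sqrt 2"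
        by (simp_all add: field_simps)
      then have "?a *\<^sub>R ?b *\<^sub>R p = ?c *\<^sub>R p" "?b *\<^sub>R w + ?a *\<^sub>R ?c *\<^sub>R w = (sqrt 3 / sqrt 2) *\<^sub>R w"
        by (simp_all only: scaleR_scaleR flip: scaleR_left_distrib)
      then show ?thesis
        by (simp only: scaleR_diff_right) (simp add: algebra_simps)
    qed
    have cross: "cross3 (?a *\<^sub>R (?b *\<^sub>R p - ?c *\<^sub>R w) + ?a *\<^sub>R v - ?C) (?c *\<^sub>R p + ?b *\<^sub>R w - ?C) = sqrt 3 *\<^sub>R cross3 v w"
      unfolding 1 2 by (simp add: cross_add_right cross_mult_left cross_mult_right)
    have inner: "(x - ?C) \<bullet> cross3 v w = x \<bullet> cross3 v w - ?c * (p \<bullet> cross3 v w)" for x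
    proof -
      have "v \<bullet> cross3 v w = 0" "w \<bullet> cross3 v w = 0" by (simp_all add: dot_cross_self)
      moreover have "?a * (?b * u) = ?c * u" for u by (simp add: field_simps)
      ultimately show ?thesis by (simp only: inner_diff_left inner_scaleR_left)  simp
    qed
    have "?I (((x - ?C) \<bullet> (sqrt 3 *\<^sub>R cross3 v w)) * ((y - ?C) \<bullet> (sqrt 3 *\<^sub>R cross3 v w))) =
      ?I ((x \<bullet> cross3 v w - ?c * (p \<bullet> cross3 v w)) * (y \<bullet> cross3 v w - ?c * (p \<bullet> cross3 v w)))" for x y
    proof -
      have "sqrt 3 * s * (sqrt 3 * t) \<le> 0 \<longleftrightarrow> s * t \<le> 0" for s t :: real
      proof -
        have "sqrt 3 * s * (sqrt 3 * t) = (sqrt 3 * sqrt 3) * (s * t)"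
          by (simp only: mult_ac)
        then have "sqrt 3 * s * (sqrt 3 * t) = 3 * (s * t)"
          by (simp only: real_sqrt_mult_self abs_numeral)
        then show ?thesis by linarith
      qed
      then show ?thesis
        unfolding inner_scaleR_right inner by (simp only: indicator_def mem_Collect_eq)
    qed
    then show ?thesis
      unfolding W_def V_def cross by simp
  qed
  have "(\<integral>\<^sup>+c. \<integral>\<^sup>+d. \<integral>\<^sup>+e. W c d e \<partial>?G \<partial>?G \<partial>?G) =
    (\<integral>\<^sup>+u. \<integral>\<^sup>+v. \<integral>\<^sup>+e. W (?a *\<^sub>R u - ?a *\<^sub>R v) (?a *\<^sub>R u + ?a *\<^sub>R v) e \<partial>?G \<partial>?G \<partial>?G)"
    by (rule nn_integral_std_gaussian_rotate[of "\<lambda>c d. \<integral>\<^sup>+e. W c d e \<partial>?G", symmetric])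
       (measurable, auto simp: power_divide)
  \<comment> \<open>With \<open>v\<close> outermost it acts as a parameter while the second rotation
    mixes \<open>u\<close> and \<open>e\<close>.\<close>
  also have "\<dots> = (\<integral>\<^sup>+v. \<integral>\<^sup>+u. \<integral>\<^sup>+e. W (?a *\<^sub>R u - ?a *\<^sub>R v) (?a *\<^sub>R u + ?a *\<^sub>R v) e \<partial>?G \<partial>?G \<partial>?G)"
    by (rule std_gaussian_pair.Fubini'[symmetric]) measurable
  also have "\<dots> = (\<integral>\<^sup>+v. \<integral>\<^sup>+p. \<integral>\<^sup>+w. V p (cross3 v w) \<partial>?G \<partial>?G \<partial>?G)"
  proof (rule nn_integral_cong)
    fix v :: "real^3"
    show "(\<integral>\<^sup>+u. \<integral>\<^sup>+e. W (?a *\<^sub>R u - ?a *\<^sub>R v) (?a *\<^sub>R u + ?a *\<^sub>R v) e \<partial>?G \<partial>?G) =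
        (\<integral>\<^sup>+p. \<integral>\<^sup>+w. V p (cross3 v w) \<partial>?G \<partial>?G)"
      unfolding W_eq[symmetric]
      by (rule nn_integral_std_gaussian_rotate
          [of "\<lambda>u e. W (?a *\<^sub>R u - ?a *\<^sub>R v) (?a *\<^sub>R u + ?a *\<^sub>R v) e", symmetric])
         (measurable, auto simp: power_divide)
  qed
  \<comment> \<open>Now \<open>p\<close> is integrated with \<open>v\<close> and \<open>w\<close>
    fixed, that is, conditionally on the normal.\<close>
  also have "\<dots> = (\<integral>\<^sup>+v. \<integral>\<^sup>+w. \<integral>\<^sup>+p. V p (cross3 v w) \<partial>?G \<partial>?G \<partial>?G)"
    by (intro nn_integral_cong std_gaussian_pair.Fubini') measurable
  also have "\<dots> = (\<integral>\<^sup>+v. \<integral>\<^sup>+w. ennreal (2 / pi * arctan (sqrt (3 / 5))) \<partial>?G \<partial>?G)"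
  proof (rule nn_integral_cong_AE)
    have "(\<integral>\<^sup>+w. \<integral>\<^sup>+p. V p (cross3 v w) \<partial>?G \<partial>?G) = (\<integral>\<^sup>+w. ennreal (2 / pi * arctan (sqrt (3 / 5))) \<partial>?G)"
      if "v \<noteq> 0" for v
    proof (rule nn_integral_cong_AE)
      have "1 / sqrt (1 + 2 * (1 / sqrt 3)\<^sup>2) = sqrt (3 / 5)"
        by (simp add: power_divide real_sqrt_divide)
      then have "(\<integral>\<^sup>+p. V p n \<partial>?G) = ennreal (2 / pi * arctan (sqrt (3 / 5)))" if "n \<noteq> 0" for n
        unfolding V_def using std_gaussian_opposite_sides[OF that, of "1 / sqrt 3"] by simp
      note V = this
      show "AE w in ?G. (\<integral>\<^sup>+p. V p (cross3 v w) \<partial>?G) = ennreal (2 / pi * arctan (sqrt (3 / 5)))"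
        using AE_std_gaussian_cross3[OF that, of 0] by eventually_elim (simp add: V)
    qed
    note eq = this
    show "AE v in ?G. (\<integral>\<^sup>+w. \<integral>\<^sup>+p. V p (cross3 v w) \<partial>?G \<partial>?G) = (\<integral>\<^sup>+w. ennreal (2 / pi * arctan (sqrt (3 / 5))) \<partial>?G)"
      using AE_std_gaussian_neq[of 0] by eventually_elim (rule eq)
  qed
  also have "\<dots> = ennreal (2 / pi * arctan (sqrt (3 / 5)))"
    by (simp add: std_gaussian.emeasure_space_1[simplified])
  finally show ?thesis by (simp only: W_def)
qed

text \<open>Half-angle formula: cos (2 arctan k) = (1 - k^2) / (1 + k^2), which is 1/4 for k^2 =
  3/5.\<close>

lemma two_arctan_sqrt_three_fifths: "2 / pi * arctan (sqrt (3 / 5)) = 1 / 2 - arcsin (1 / 4) / pi"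
proof -
  let ?k = "sqrt (3 / 5 :: real)"
  have k: "0 < ?k" "?k < 1" by auto
  have "cos (2 * arctan ?k) = 1 / 4"
    by (simp add: cos_double cos_arctan sin_arctan power_divide)
  moreover have "0 \<le> 2 * arctan ?k" "2 * arctan ?k \<le> pi"
    using k arctan_ubound[of ?k] by auto
  ultimately have "2 * arctan ?k = arccos (1 / 4)"
    using arccos_cos[of "2 * arctan ?k"] by metis
  also have "\<dots> = pi / 2 - arcsin (1 / 4)"
    by (rule arccos_arcsin_eq) auto
  finally show ?thesis by (simp add: field_simps)
qed

section \<open>Affine dependences and convex position\<close>

text \<open>An empty side has an empty hull, and a one-point side says exactly that this point lies
  in the hull of the others. Radon's theorem provides some partition, whose smaller side has at most
  2 of the 5 points. Hence the minimum is 2 iff size 1 is excluded, for every configuration,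
  degenerate ones included.\<close>

lemma radon_smaller_side_eq_2_iff:
  fixes x :: "'i \<Rightarrow> 'a::euclidean_space"
  assumes "DIM('a) = 3" "card I = 5"
  shows "radon_smaller_side I x = 2 \<longleftrightarrow> convex_position I x"
proof -
  let ?R = "\<lambda>k. \<exists>A B. radon_partition I x A B \<and> k = min (card A) (card B)"
  have "finite I" using assms(2) by (simp add: card_ge_0_finite)
  have fin: "finite A" "finite B" if "radon_partition I x A B" for A B
    using that \<open>finite I\<close> by (auto simp: radon_partition_def)
  have R0: "\<not> ?R 0"
  proof
    assume "?R 0"
    then obtain A B where R: "radon_partition I x A B" "card A = 0 \<or> card B = 0"
      by (metis min_def)
    then have "A = {} \<or> B = {}" using fin[OF R(1)] by auto
    then show False using R(1) by (auto simp: radon_partition_def)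
  qed
  have R1: "?R 1 \<longleftrightarrow> \<not> convex_position I x"
  proof
    assume "?R 1"
    then obtain A B where R: "radon_partition I x A B" "card A = 1 \<or> card B = 1"
      by (metis min_def)
    obtain C C' where C: "radon_partition I x C C'" "card C = 1"
      using R by (auto simp: radon_partition_def Int_commute Un_commute)
    then obtain i where "C = {i}" by (auto simp: card_1_singleton_iff)
    with C(1) have "i \<in> I" "C' = I - {i}" "x i \<in> convex hull (x ` C')"
      by (auto simp: radon_partition_def)
    then show "\<not> convex_position I x" by (auto simp: convex_position_def)
  next
    assume "\<not> convex_position I x"
    then obtain i where i: "i \<in> I" "x i \<in> convex hull (x ` (I - {i}))"
      by (auto simp: convex_position_def)
    then have "radon_partition I x {i} (I - {i})"
      by (auto simp: radon_partition_def)
    moreover have "card (I - {i}) = 4" using i assms(2) by simp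
    ultimately show "?R 1"
      by (intro exI[of _ "{i}"] exI[of _ "I - {i}"]) simp
  qed
  show ?thesis
  proof
    assume *: "radon_smaller_side I x = 2"
    show "convex_position I x"
    proof (rule ccontr)
      assume "\<not> convex_position I x"
      then have "?R 1" using R1 by blast
      then have "radon_smaller_side I x \<le> 1"
        unfolding radon_smaller_side_def by (rule Least_le)
      with * show False by simp
    qed
  next
    assume conv: "convex_position I x"
    \<comment> \<open>Radon's theorem speaks of sets of points; convex position excludes
      repetitions, so the set of points again has 5 elements and its parts pull back to index
      sets.\<close>
    have inj: "inj_on x I"
    proof (rule inj_onI, rule ccontr)
      fix i j assume ij: "i \<in> I" "j \<in> I" "x i = x j" "i \<noteq> j"
      then have "x i \<in> convex hull (x ` (I - {i}))" by (intro hull_inc) auto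
      then show False using conv ij(1) by (auto simp: convex_position_def)
    qed
    have "affine_dependent (x ` I)"
      using assms \<open>finite I\<close> by (intro affine_dependent_biggerset) (auto simp: card_image[OF inj])
    then obtain P Q where PQ: "P \<inter> Q = {}" "P \<union> Q = x ` I" "convex hull P \<inter> convex hull Q \<noteq> {}"
      using Radon_partition[of "x ` I"] \<open>finite I\<close> by auto
    define A B where "A = {i \<in> I. x i \<in> P}" and "B = {i \<in> I. x i \<in> Q}"
    have "x ` A = P" "x ` B = Q" using PQ(2) by (auto simp: A_def B_def)
    then have AB: "radon_partition I x A B"
      using PQ by (auto simp: radon_partition_def A_def B_def)
    then have "card A + card B = 5"
      using assms(2) fin[OF AB] by (metis card_Un_disjoint radon_partition_def)
    then have "min (card A) (card B) \<le> 2" by linarith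
    moreover have "min (card A) (card B) \<noteq> 0" "min (card A) (card B) \<noteq> 1"
      using AB R0 R1 conv by metis+
    ultimately have "min (card A) (card B) = 2" by linarith
    then have "?R 2" using AB by metis
    then show "radon_smaller_side I x = 2"
      unfolding radon_smaller_side_def
    proof (rule Least_equality)
      fix k assume "?R k"
      then have "k \<noteq> 0" "k \<noteq> 1" using R0 R1 conv by metis+
      then show "2 \<le> k" by linarith
    qed
  qed
qed

text \<open>Viewing the image as a union of singletons gives weights per index, so repeated points
  are covered.\<close>

lemma convex_hull_image_finite:
  fixes x :: "'i \<Rightarrow> 'a::euclidean_space"
  assumes "finite J"
  shows "convex hull (x ` J) = {\<Sum>i\<in>J. u i *\<^sub>R x i | u. (\<forall>i\<in>J. 0 \<le> u i) \<and> sum u J = 1}"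
proof -
  have "x ` J = \<Union>((\<lambda>i. {x i}) ` J)" by auto
  then have "convex hull (x ` J) =
      {\<Sum>i\<in>J. u i *\<^sub>R s i | u s. (\<forall>i\<in>J. 0 \<le> u i) \<and> sum u J = 1 \<and> (\<forall>i\<in>J. s i \<in> {x i})}"
    using convex_hull_finite_union[OF assms, of "\<lambda>i. {x i}"] by simp
  also have "\<dots> = {\<Sum>i\<in>J. u i *\<^sub>R x i | u. (\<forall>i\<in>J. 0 \<le> u i) \<and> sum u J = 1}"
    by (auto intro!: sum.cong)
  finally show ?thesis .
qed

section \<open>Signs of affine dependences\<close>

definition affine_dependence :: "'i set \<Rightarrow> ('i \<Rightarrow> 'a::real_vector) \<Rightarrow> ('i \<Rightarrow> real) \<Rightarrow> bool" where
  "affine_dependence I x c \<longleftrightarrow>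
     sum c I = 0 \<and> (\<Sum>i\<in>I. c i *\<^sub>R x i) = 0 \<and> (\<exists>i\<in>I. c i \<noteq> 0)"

lemma affine_dependence_exists:
  fixes x :: "'i \<Rightarrow> 'a::euclidean_space"
  assumes "finite I" "DIM('a) + 2 \<le> card I"
  shows "\<exists>c. affine_dependence I x c"
proof (cases "inj_on x I")
  case True
  then have "affine_dependent (x ` I)"
    using assms by (intro affine_dependent_biggerset) (auto simp: card_image)
  then obtain u v where "sum u (x ` I) = 0" "v \<in> x ` I" "u v \<noteq> 0" "(\<Sum>v\<in>x ` I. u v *\<^sub>R v) = 0"
    using affine_dependent_explicit_finite[of "x ` I"] assms(1) by auto
  then have "affine_dependence I x (u \<circ> x)"
    using True by (auto simp: affine_dependence_def sum.reindex)
  then show ?thesis by blast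
next
  case False
  then obtain i j where ij: "i \<in> I" "j \<in> I" "x i = x j" "i \<noteq> j" by (auto simp: inj_on_def)
  \<comment> \<open>Coinciding points carry a dependence with coefficients 1 and -1 and zeros
    elsewhere.\<close>
  let ?c = "\<lambda>k. (if k = i then 1 else 0) - (if k = j then 1 else 0 :: real)"
  have "(\<Sum>k\<in>I. ?c k *\<^sub>R x k) = (\<Sum>k\<in>I. (if k = i then x k else 0) - (if k = j then x k else 0))"
    by (intro sum.cong) (auto simp: scaleR_diff_left)
  then have "affine_dependence I x ?c"
    using ij assms(1) by (auto simp: affine_dependence_def sum_subtractf)
  then show ?thesis by blast
qed

text \<open>A convex combination representing \<open>x i\<close> is a dependence with -1 at
  \<open>i\<close> and nonnegative weights elsewhere; conversely, a dependence in which
  \<open>i\<close> is alone with its sign becomes such a combination after division by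
  \<open>- c i\<close>. The combination need not be a multiple of \<open>c\<close>, so
  \<open>sgn\<close> carries its signs over to \<open>c\<close>, and \<open>nz\<close> makes the
  weights strictly positive.\<close>

lemma convex_position_iff_affine_dependence:
  fixes x :: "'i \<Rightarrow> 'a::euclidean_space"
  assumes "finite I" and dep: "affine_dependence I x c"
    and sgn: "\<And>i j a b. \<lbrakk>i \<in> I; j \<in> I; i \<noteq> j; affine_dependence I x a; affine_dependence I x b\<rbrakk> \<Longrightarrow>
      a i * a j < 0 \<longleftrightarrow> b i * b j < 0"
    and nz: "\<And>i a. \<lbrakk>i \<in> I; affine_dependence I x a\<rbrakk> \<Longrightarrow> a i \<noteq> 0"
  shows "convex_position I x \<longleftrightarrow> \<not> (\<exists>i\<in>I. \<forall>j\<in>I - {i}. c i * c j < 0)"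
proof -
  have "x i \<in> convex hull (x ` (I - {i})) \<longleftrightarrow> (\<forall>j\<in>I - {i}. c i * c j < 0)" if i: "i \<in> I" for i
  proof
    assume "x i \<in> convex hull (x ` (I - {i}))"
    then obtain u where u: "\<forall>j\<in>I - {i}. 0 \<le> u j" "sum u (I - {i}) = 1"
        "x i = (\<Sum>j\<in>I - {i}. u j *\<^sub>R x j)"
      using assms(1) by (auto simp: convex_hull_image_finite)
    define a where "a = u(i := -1)"
    have "sum a I = a i + sum a (I - {i})" "(\<Sum>j\<in>I. a j *\<^sub>R x j) = a i *\<^sub>R x i + (\<Sum>j\<in>I - {i}. a j *\<^sub>R x j)"
      using i assms(1) by (auto simp: sum.remove)
    moreover have "sum a (I - {i}) = 1" "(\<Sum>j\<in>I - {i}. a j *\<^sub>R x j) = x i"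
      using u by (auto simp: a_def)
    ultimately have a: "affine_dependence I x a"
      using i by (auto simp: affine_dependence_def a_def)
    show "\<forall>j\<in>I - {i}. c i * c j < 0"
    proof
      fix j assume j: "j \<in> I - {i}"
      then have "a j > 0" using bspec[OF u(1) j] nz[OF _ a, of j] by (auto simp: a_def)
      then have "a i * a j < 0" by (simp add: a_def)
      then show "c i * c j < 0" using sgn[OF i _ _ a dep] j by auto
    qed
  next
    assume c: "\<forall>j\<in>I - {i}. c i * c j < 0"
    have ci: "c i \<noteq> 0" by (rule nz[OF i dep])
    define u where "u j = - c j / c i" for j
    have "c i + sum c (I - {i}) = 0" "c i *\<^sub>R x i + (\<Sum>j\<in>I - {i}. c j *\<^sub>R x j) = 0"
      using i assms(1) dep by (auto simp: affine_dependence_def sum.remove)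
    then have "sum c (I - {i}) = - c i" and x: "(\<Sum>j\<in>I - {i}. c j *\<^sub>R x j) = - (c i *\<^sub>R x i)"
      by (simp_all add: eq_neg_iff_add_eq_0 add.commute)
    then have "sum u (I - {i}) = 1"
      using ci by (simp add: u_def sum_negf flip: sum_divide_distrib)
    moreover have "(\<Sum>j\<in>I - {i}. u j *\<^sub>R x j) = x i"
    proof -
      have "(\<Sum>j\<in>I - {i}. u j *\<^sub>R x j) = (- 1 / c i) *\<^sub>R (\<Sum>j\<in>I - {i}. c j *\<^sub>R x j)"
        by (simp add: u_def scaleR_sum_right sum_negf)
      then show ?thesis using ci by (simp add: x)
    qed
    moreover have "\<forall>j\<in>I - {i}. 0 \<le> u j"
    proof
      fix j assume "j \<in> I - {i}"
      then have "c i * c j < 0" using c by blast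
      then show "0 \<le> u j"
        by (auto simp: u_def mult_less_0_iff divide_le_0_iff)
    qed
    ultimately show "x i \<in> convex hull (x ` (I - {i}))"
      using assms(1) by (auto simp: convex_hull_image_finite intro!: exI[of _ u])
  qed
  then show ?thesis by (auto simp: convex_position_def)
qed

text \<open>Since the coefficients sum to 0, both signs occur and the split is 1-4 or 2-3. Ordered
  pairs are counted: 4 * 3 = 12 in the first case, 2 * 1 + 3 * 2 = 8 in the second.\<close>

lemma card_same_sign_pairs:
  fixes c :: "'i \<Rightarrow> real"
  assumes "card I = 5" "sum c I = 0" and nz: "\<And>i. i \<in> I \<Longrightarrow> c i \<noteq> 0"
  shows "card {(i, j). i \<in> I \<and> j \<in> I \<and> i \<noteq> j \<and> 0 < c i * c j} =
    (if \<exists>i\<in>I. \<forall>j\<in>I - {i}. c i * c j < 0 then 12 else 8)"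
proof -
  have [simp]: "finite I" using assms(1) by (simp add: card_ge_0_finite)
  define P where "P = {i \<in> I. 0 < c i}"
  define N where "N = {i \<in> I. c i < 0}"
  have [simp]: "finite P" "finite N" by (auto simp: P_def N_def)
  have PN: "P \<inter> N = {}" "P \<union> N = I" using nz by (force simp: P_def N_def)+
  have card: "card P + card N = 5"
    using card_Un_disjoint[of P N] PN assms(1) by simp
  have "I \<noteq> {}" using assms(1) by auto
  have "P \<noteq> {}"
  proof
    assume "P = {}"
    then have "0 < (\<Sum>i\<in>I. - c i)" using \<open>I \<noteq> {}\<close> PN by (intro sum_pos) (auto simp: N_def)
    with assms(2) show False by (simp add: sum_negf)
  qed
  have "N \<noteq> {}"
  proof
    assume "N = {}"
    then have "sum c I > 0" using \<open>I \<noteq> {}\<close> PN by (intro sum_pos) (auto simp: P_def)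
    with assms(2) show False by simp
  qed
  have off_diag: "card (A \<times> A - (\<lambda>i. (i, i)) ` A) = card A * card A - card A" if "finite A" for A :: "'i set"
    using that by (subst card_Diff_subset) (auto simp: card_image inj_on_def card_cartesian_product)
  have "{(i, j). i \<in> I \<and> j \<in> I \<and> i \<noteq> j \<and> 0 < c i * c j} =
    (P \<times> P - (\<lambda>i. (i, i)) ` P) \<union> (N \<times> N - (\<lambda>i. (i, i)) ` N)"
    by (auto simp: P_def N_def zero_less_mult_iff)
  then have "card {(i, j). i \<in> I \<and> j \<in> I \<and> i \<noteq> j \<and> 0 < c i * c j} =
    (card P * card P - card P) + (card N * card N - card N)"
    using PN(1) by (simp only:) (subst card_Un_disjoint, auto simp: off_diag)
  moreover have "(\<exists>i\<in>I. \<forall>j\<in>I - {i}. c i * c j < 0) \<longleftrightarrow> card P = 1 \<or> card N = 1"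
  proof
    assume "\<exists>i\<in>I. \<forall>j\<in>I - {i}. c i * c j < 0"
    then obtain i where i: "i \<in> I" "\<And>j. j \<in> I \<Longrightarrow> j \<noteq> i \<Longrightarrow> c i * c j < 0" by auto
    show "card P = 1 \<or> card N = 1"
    proof (cases "c i > 0")
      case True
      then have "P = {i}" using i by (fastforce simp: P_def mult_less_0_iff)
      then show ?thesis by simp
    next
      case False
      then have "N = {i}" using i nz[OF i(1)] by (fastforce simp: N_def mult_less_0_iff)
      then show ?thesis by simp
    qed
  next
    assume "card P = 1 \<or> card N = 1"
    then obtain i where "P = {i} \<or> N = {i}" by (auto simp: card_1_singleton_iff)
    then show "\<exists>i\<in>I. \<forall>j\<in>I - {i}. c i * c j < 0"
    proof
      assume P: "P = {i}"
      then have "\<forall>j\<in>I - {i}. j \<in> N" using PN by auto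
      moreover have "c i > 0" "i \<in> I" using P by (auto simp: P_def)
      ultimately show ?thesis by (intro bexI[of _ i]) (auto simp: N_def mult_less_0_iff)
    next
      assume N: "N = {i}"
      then have "\<forall>j\<in>I - {i}. j \<in> P" using PN by auto
      moreover have "c i < 0" "i \<in> I" using N by (auto simp: N_def)
      ultimately show ?thesis by (intro bexI[of _ i]) (auto simp: P_def mult_less_0_iff)
    qed
  qed
  moreover have "card P \<noteq> 0" "card N \<noteq> 0" using \<open>P \<noteq> {}\<close> \<open>N \<noteq> {}\<close> by auto
  then have "card P = 1 \<and> card N = 4 \<or> card P = 2 \<and> card N = 3 \<or> card P = 3 \<and> card N = 2 \<or> card P = 4 \<and> card N = 1"
    using card by linarith
  ultimately show ?thesis by auto
qed

text \<open>Positive and negative on the two sides of the plane through \<open>p\<close>, \<open>q\<close>, \<open>r\<close>, and identically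
  zero if these points are collinear.\<close>

definition plane_side :: "real^3 \<Rightarrow> real^3 \<Rightarrow> real^3 \<Rightarrow> real^3 \<Rightarrow> real" where
  "plane_side p q r a = (a - p) \<bullet> cross3 (q - p) (r - p)"

lemma plane_side_vertices [simp]:
  "plane_side p q r p = 0" "plane_side p q r q = 0" "plane_side p q r r = 0"
  by (simp_all add: plane_side_def dot_cross_self)

lemma sum_affine_dependence_plane_side:
  assumes "affine_dependence I x c"
  shows "(\<Sum>i\<in>I. c i * plane_side p q r (x i)) = 0"
proof -
  have "(\<Sum>i\<in>I. c i * plane_side p q r (x i)) =
      ((\<Sum>i\<in>I. c i *\<^sub>R x i) - sum c I *\<^sub>R p) \<bullet> cross3 (q - p) (r - p)"
    by (simp add: plane_side_def inner_diff_left inner_sum_left scaleR_sum_left sum_subtractf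
        right_diff_distrib sum_distrib_right)
  then show ?thesis using assms by (simp add: affine_dependence_def)
qed

text \<open>Testing the dependence with the plane through the points \<open>k\<close>,
  \<open>l\<close>, \<open>m\<close> kills their three terms and leaves
  \<open>c i * ?s + c j * ?t = 0\<close>: the coefficients have equal signs exactly when the two
  points lie on opposite sides.\<close>

lemma affine_dependence_sign:
  assumes "affine_dependence {i, j, k, l, m} x c" "distinct [i, j, k, l, m]"
    and "plane_side (x k) (x l) (x m) (x i) * plane_side (x k) (x l) (x m) (x j) \<noteq> 0"
  shows "c i = 0 \<longleftrightarrow> c j = 0"
    and "c i \<noteq> 0 \<Longrightarrow> 0 < c i * c j \<longleftrightarrow>
      plane_side (x k) (x l) (x m) (x i) * plane_side (x k) (x l) (x m) (x j) < 0"
      (is "_ \<Longrightarrow> _ \<longleftrightarrow> ?s * ?t < 0")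
proof -
  from sum_affine_dependence_plane_side[OF assms(1), of "x k" "x l" "x m"] assms(2)
  have eq: "c i * ?s + c j * ?t = 0" by simp
  with assms(3) show iff: "c i = 0 \<longleftrightarrow> c j = 0" by auto
  show "0 < c i * c j \<longleftrightarrow> ?s * ?t < 0" if "c i \<noteq> 0"
  proof -
    \<comment> \<open>The relation \<open>c i * ?s = - (c j * ?t)\<close> multiplied by
      \<open>c j * ?s\<close>, so that both sides show a product of interest times a positive
      square.\<close>
    have "c i * c j * ?s\<^sup>2 = - ((c j)\<^sup>2 * (?s * ?t))"
      using eq by (simp add: power2_eq_square eq_neg_iff_add_eq_0) algebra
    moreover have "0 < ?s\<^sup>2" "0 < (c j)\<^sup>2" using assms(3) that iff by auto
    ultimately show ?thesis
      by (smt (verit) mult_less_0_iff zero_less_mult_iff)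
  qed
qed

text \<open>The signs of \<open>w\<close> are determined by the points alone, yet they dictate the
  relative signs of every affine dependence; thus all dependences agree. Zeros propagate between any
  two indices, so one nonzero coefficient makes all nonzero. The functions \<open>k\<close>,
  \<open>l\<close>, \<open>m\<close> pick the three indices that complete a pair.\<close>

lemma card_opposite_side_pairs:
  fixes x :: "'i \<Rightarrow> real^3"
  assumes "card I = 5"
    and I: "\<And>i j. \<lbrakk>i \<in> I; j \<in> I; i \<noteq> j\<rbrakk> \<Longrightarrow> I = {i, j, k i j, l i j, m i j}"
    and w: "\<And>i j. w i j = plane_side (x (k i j)) (x (l i j)) (x (m i j)) (x i) *
      plane_side (x (k i j)) (x (l i j)) (x (m i j)) (x j)"
    and nz: "\<And>i j. \<lbrakk>i \<in> I; j \<in> I; i \<noteq> j\<rbrakk> \<Longrightarrow> w i j \<noteq> 0"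
  shows "card {(i, j). i \<in> I \<and> j \<in> I \<and> i \<noteq> j \<and> w i j < 0} = (if convex_position I x then 8 else 12)"
proof -
  have "finite I" using assms(1) by (simp add: card_ge_0_finite)
  have dist: "distinct [i, j, k i j, l i j, m i j]" if "i \<in> I" "j \<in> I" "i \<noteq> j" for i j
    using I[OF that] assms(1) by (intro card_distinct) simp
  have zero: "a i = 0 \<longleftrightarrow> a j = 0"
    if "affine_dependence I x a" "i \<in> I" "j \<in> I" "i \<noteq> j" for a i j
    using affine_dependence_sign(1)[of i j "k i j" "l i j" "m i j" x a] I[OF that(2-4)] dist[OF that(2-4)]
      nz[OF that(2-4)] that(1) unfolding w by metis
  have nonzero: "a i \<noteq> 0" if i: "i \<in> I" and a: "affine_dependence I x a" for a i
  proof -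
    obtain j where "j \<in> I" "a j \<noteq> 0" using a by (auto simp: affine_dependence_def)
    then show ?thesis using zero[OF a i] by (cases "i = j") auto
  qed
  have pos: "0 < a i * a j \<longleftrightarrow> w i j < 0"
    if "affine_dependence I x a" "i \<in> I" "j \<in> I" "i \<noteq> j" for a i j
    using affine_dependence_sign(2)[of i j "k i j" "l i j" "m i j" x a] I[OF that(2-4)] dist[OF that(2-4)]
      nz[OF that(2-4)] nonzero[OF that(2,1)] that(1) unfolding w by metis
  have neg: "a i * a j < 0 \<longleftrightarrow> w i j > 0"
    if "affine_dependence I x a" "i \<in> I" "j \<in> I" "i \<noteq> j" for a i j
    using pos[OF that] nz[OF that(2-4)] nonzero[OF that(2,1)] nonzero[OF that(3,1)]
    by (smt (verit) mult_eq_0_iff)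
  obtain c where c: "affine_dependence I x c"
    using affine_dependence_exists[OF \<open>finite I\<close>, of x] assms(1) by auto
  have conv: "convex_position I x \<longleftrightarrow> \<not> (\<exists>i\<in>I. \<forall>j\<in>I - {i}. c i * c j < 0)"
    using neg nonzero by (intro convex_position_iff_affine_dependence[OF \<open>finite I\<close> c]) auto
  have "{(i, j). i \<in> I \<and> j \<in> I \<and> i \<noteq> j \<and> w i j < 0} = {(i, j). i \<in> I \<and> j \<in> I \<and> i \<noteq> j \<and> 0 < c i * c j}"
    using pos[OF c] by auto
  also have "card \<dots> = (if \<exists>i\<in>I. \<forall>j\<in>I - {i}. c i * c j < 0 then 12 else 8)"
    using c nonzero[OF _ c] by (intro card_same_sign_pairs assms(1)) (auto simp: affine_dependence_def)
  also have "\<dots> = (if convex_position I x then 8 else 12)"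
    unfolding conv by simp
  finally show ?thesis .
qed

section \<open>Measurability of convex position\<close>

text \<open>Strict separation is an open condition on the direction, so countably many directions
  suffice; this makes convex position measurable without discarding a null set.\<close>

lemma not_in_convex_hull_image_iff:
  fixes y :: "'a::euclidean_space"
  assumes "finite J" and D: "\<And>U::'a set. \<lbrakk>open U; U \<noteq> {}\<rbrakk> \<Longrightarrow> \<exists>v\<in>D. v \<in> U"
  shows "y \<notin> convex hull (x ` J) \<longleftrightarrow> (\<exists>v\<in>D. \<forall>j\<in>J. v \<bullet> x j < v \<bullet> y)"
proof
  assume "y \<notin> convex hull (x ` J)"
  moreover have "closed (convex hull (x ` J))"
    using assms(1) by (intro compact_imp_closed finite_imp_compact_convex_hull) simp
  ultimately obtain a b where ab: "a \<bullet> y < b" "\<forall>z\<in>convex hull (x ` J). b < a \<bullet> z"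
    using separating_hyperplane_closed_point[OF convex_convex_hull] by blast
  have "- a \<in> {v. \<forall>j\<in>J. v \<bullet> x j < v \<bullet> y}"
    using ab by (auto simp: hull_inc intro: less_trans)
  moreover have "open {v. \<forall>j\<in>J. v \<bullet> x j < v \<bullet> y}"
  proof -
    have "{v. \<forall>j\<in>J. v \<bullet> x j < v \<bullet> y} = (\<Inter>j\<in>J. {v. v \<bullet> x j < v \<bullet> y})" by auto
    then show ?thesis
      using assms(1) by (auto intro!: open_INT open_Collect_less continuous_intros)
  qed
  ultimately show "\<exists>v\<in>D. \<forall>j\<in>J. v \<bullet> x j < v \<bullet> y"
    using D[of "{v. \<forall>j\<in>J. v \<bullet> x j < v \<bullet> y}"] by blast
next
  assume "\<exists>v\<in>D. \<forall>j\<in>J. v \<bullet> x j < v \<bullet> y"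
  then obtain v where "\<forall>j\<in>J. v \<bullet> x j < v \<bullet> y" by blast
  then have "convex hull (x ` J) \<subseteq> {z. v \<bullet> z < v \<bullet> y}"
    by (intro hull_minimal convex_halfspace_lt) auto
  then show "y \<notin> convex hull (x ` J)" by auto
qed

lemma pred_convex_position:
  fixes X :: "'i \<Rightarrow> 'w \<Rightarrow> 'a::euclidean_space"
  assumes "finite I" and [measurable]: "\<And>i. i \<in> I \<Longrightarrow> X i \<in> borel_measurable M"
  shows "Measurable.pred M (\<lambda>\<omega>. convex_position I (\<lambda>i. X i \<omega>))"
proof -
  obtain D :: "'a set" where D: "countable D" "\<And>U. \<lbrakk>open U; U \<noteq> {}\<rbrakk> \<Longrightarrow> \<exists>v\<in>D. v \<in> U"
    by (rule countable_dense_setE) blast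
  have "convex_position I (\<lambda>i. X i \<omega>) \<longleftrightarrow> (\<forall>i\<in>I. \<exists>v\<in>D. \<forall>j\<in>I - {i}. v \<bullet> X j \<omega> < v \<bullet> X i \<omega>)" for \<omega>
    unfolding convex_position_def
    using not_in_convex_hull_image_iff[OF _ D(2), of "I - {_}" _ "\<lambda>i. X i \<omega>"] assms(1) by simp
  moreover have "Measurable.pred M (\<lambda>\<omega>. \<forall>i\<in>I. \<exists>v\<in>D. \<forall>j\<in>I - {i}. v \<bullet> X j \<omega> < v \<bullet> X i \<omega>)"
  proof (rule pred_intros_finite(3)[OF \<open>finite I\<close>])
    fix i assume i: "i \<in> I"
    have [measurable]: "X i \<in> borel_measurable M" by (rule assms(2)[OF i])
    have "Measurable.pred M (\<lambda>\<omega>. \<forall>j\<in>I - {i}. v \<bullet> X j \<omega> < v \<bullet> X i \<omega>)" for v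
    proof (rule pred_intros_finite(3))
      fix j assume "j \<in> I - {i}"
      then have [measurable]: "X j \<in> borel_measurable M" using assms(2) by auto
      show "Measurable.pred M (\<lambda>\<omega>. v \<bullet> X j \<omega> < v \<bullet> X i \<omega>)" by measurable
    qed (use \<open>finite I\<close> in auto)
    then show "Measurable.pred M (\<lambda>\<omega>. \<exists>v\<in>D. \<forall>j\<in>I - {i}. v \<bullet> X j \<omega> < v \<bullet> X i \<omega>)"
      unfolding pred_def by (rule sets.sets_Collect_countable_Ex'[OF _ D(1)])
  qed
  ultimately show ?thesis by simp
qed

section \<open>The probability of convex position\<close>

text \<open>One coordinate is split off at a time. The three indices spanning the plane come first,
  so the two tested points end up in the innermost integrals.\<close>

lemma nn_integral_PiM_std_gaussian_5:
  fixes g :: "'a::euclidean_space \<Rightarrow> 'a \<Rightarrow> 'a \<Rightarrow> 'a \<Rightarrow> 'a \<Rightarrow> ennreal"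
  assumes [measurable]: "(\<lambda>(a, b, c, d, e). g a b c d e) \<in>
      borel_measurable (borel \<Otimes>\<^sub>M borel \<Otimes>\<^sub>M borel \<Otimes>\<^sub>M borel \<Otimes>\<^sub>M borel)"
    and dist: "distinct [k, l, m, i, j :: 'i]"
  shows "(\<integral>\<^sup>+x. g (x k) (x l) (x m) (x i) (x j) \<partial>Pi\<^sub>M {k, l, m, i, j} (\<lambda>_. std_gaussian)) =
    (\<integral>\<^sup>+a. \<integral>\<^sup>+b. \<integral>\<^sup>+c. \<integral>\<^sup>+d. \<integral>\<^sup>+e. g a b c d e
      \<partial>std_gaussian \<partial>std_gaussian \<partial>std_gaussian \<partial>std_gaussian \<partial>std_gaussian)"
proof -
  interpret product_sigma_finite "\<lambda>_. std_gaussian :: 'a measure" ..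
  have g: "(\<lambda>x. g (f1 x) (f2 x) (f3 x) (f4 x) (f5 x)) \<in> borel_measurable N"
    if [measurable]: "f1 \<in> borel_measurable N" "f2 \<in> borel_measurable N" "f3 \<in> borel_measurable N"
      "f4 \<in> borel_measurable N" "f5 \<in> borel_measurable N"
    for N :: "('i \<Rightarrow> 'a) measure" and f1 f2 f3 f4 f5
  proof -
    have "(\<lambda>x. (\<lambda>(a, b, c, d, e). g a b c d e) (f1 x, f2 x, f3 x, f4 x, f5 x)) \<in> borel_measurable N"
      by (rule measurable_compose[OF _ assms(1)]) measurable
    then show ?thesis by simp
  qed
  have coord: "(\<lambda>x. x p) \<in> borel_measurable (Pi\<^sub>M J (\<lambda>_. std_gaussian :: 'a measure))" if "p \<in> J" for p :: 'i and J
    using measurable_component_singleton[OF that, of "\<lambda>_. std_gaussian :: 'a measure"]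
    unfolding measurable_cong_sets[OF refl sets_std_gaussian] .
  let ?G = "\<lambda>_. std_gaussian :: 'a measure"
  have "(\<integral>\<^sup>+x. g (x k) (x l) (x m) (x i) (x j) \<partial>Pi\<^sub>M {k, l, m, i, j} ?G) =
      (\<integral>\<^sup>+a. \<integral>\<^sup>+x. g a (x l) (x m) (x i) (x j) \<partial>Pi\<^sub>M {l, m, i, j} ?G \<partial>std_gaussian)"
    by (subst product_nn_integral_insert_rev) (use dist in \<open>auto intro!: g coord\<close>)
  moreover have "(\<integral>\<^sup>+x. g a (x l) (x m) (x i) (x j) \<partial>Pi\<^sub>M {l, m, i, j} ?G) =
      (\<integral>\<^sup>+b. \<integral>\<^sup>+x. g a b (x m) (x i) (x j) \<partial>Pi\<^sub>M {m, i, j} ?G \<partial>std_gaussian)" for a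
    by (subst product_nn_integral_insert_rev) (use dist in \<open>auto intro!: g coord\<close>)
  moreover have "(\<integral>\<^sup>+x. g a b (x m) (x i) (x j) \<partial>Pi\<^sub>M {m, i, j} ?G) =
      (\<integral>\<^sup>+c. \<integral>\<^sup>+x. g a b c (x i) (x j) \<partial>Pi\<^sub>M {i, j} ?G \<partial>std_gaussian)" for a b
    by (subst product_nn_integral_insert_rev) (use dist in \<open>auto intro!: g coord\<close>)
  moreover have "(\<integral>\<^sup>+x. g a b c (x i) (x j) \<partial>Pi\<^sub>M {i, j} ?G) =
      (\<integral>\<^sup>+d. \<integral>\<^sup>+x. g a b c d (x j) \<partial>Pi\<^sub>M {j} ?G \<partial>std_gaussian)" for a b c
    by (subst product_nn_integral_insert_rev) (use dist in \<open>auto intro!: g coord\<close>)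
  moreover have "(\<integral>\<^sup>+x. g a b c d (x j) \<partial>Pi\<^sub>M {j} ?G) = (\<integral>\<^sup>+e. g a b c d e \<partial>std_gaussian)" for a b c d
    by (rule product_nn_integral_singleton) (auto intro!: g)
  ultimately show ?thesis by (simp only:)
qed

context prob_space
begin

context
  fixes X :: "'i \<Rightarrow> 'a \<Rightarrow> 'b::euclidean_space" and I
  assumes indep: "indep_vars (\<lambda>_. borel) X I"
    and gauss: "\<And>i. i \<in> I \<Longrightarrow> distributed M lborel (X i) (\<lambda>x. ennreal (std_gaussian_density x))"
begin

lemma borel_measurable_gaussian: "i \<in> I \<Longrightarrow> X i \<in> borel_measurable M"
  using distributed_measurable[OF gauss] by simp

text \<open>Independence enters here: the joint law of the family is the product of its marginals,
  each of them \<open>std_gaussian\<close>.\<close>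

lemma nn_integral_gaussian_5:
  fixes g :: "'b \<Rightarrow> 'b \<Rightarrow> 'b \<Rightarrow> 'b \<Rightarrow> 'b \<Rightarrow> ennreal"
  assumes g [measurable]: "(\<lambda>(a, b, c, d, e). g a b c d e) \<in>
      borel_measurable (borel \<Otimes>\<^sub>M borel \<Otimes>\<^sub>M borel \<Otimes>\<^sub>M borel \<Otimes>\<^sub>M borel)"
    and dist: "distinct [k, l, m, i, j]" and I: "I = {k, l, m, i, j}"
  shows "(\<integral>\<^sup>+\<omega>. g (X k \<omega>) (X l \<omega>) (X m \<omega>) (X i \<omega>) (X j \<omega>) \<partial>M) =
    (\<integral>\<^sup>+a. \<integral>\<^sup>+b. \<integral>\<^sup>+c. \<integral>\<^sup>+d. \<integral>\<^sup>+e. g a b c d e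
      \<partial>std_gaussian \<partial>std_gaussian \<partial>std_gaussian \<partial>std_gaussian \<partial>std_gaussian)"
proof -
  have "I \<noteq> {}" using I by auto
  have law: "distr M borel (X p) = std_gaussian" if "p \<in> I" for p
    using gauss[OF that] by (auto simp: distributed_def std_gaussian_def cong: distr_cong)
  have "distr M (\<Pi>\<^sub>M p\<in>I. borel) (\<lambda>\<omega>. \<lambda>p\<in>I. X p \<omega>) = (\<Pi>\<^sub>M p\<in>I. distr M borel (X p))"
    using indep indep_vars_iff_distr_eq_PiM'[OF \<open>I \<noteq> {}\<close>, of X "\<lambda>_. borel"] borel_measurable_gaussian by blast
  also have "\<dots> = (\<Pi>\<^sub>M p\<in>I. std_gaussian)"
    by (intro PiM_cong refl law)
  finally have PiM: "distr M (\<Pi>\<^sub>M p\<in>I. borel) (\<lambda>\<omega>. \<lambda>p\<in>I. X p \<omega>) = (\<Pi>\<^sub>M p\<in>I. std_gaussian)" .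
  have coord: "(\<lambda>x. x p) \<in> borel_measurable (\<Pi>\<^sub>M p\<in>I. borel)" if "p \<in> I" for p
    using that by measurable
  have "(\<lambda>x. (\<lambda>(a, b, c, d, e). g a b c d e) (x k, x l, x m, x i, x j)) \<in> borel_measurable (\<Pi>\<^sub>M p\<in>I. borel)"
    by (rule measurable_compose[OF _ g]) (intro measurable_Pair coord; simp add: I)
  then have g': "(\<lambda>x. g (x k) (x l) (x m) (x i) (x j)) \<in> borel_measurable (\<Pi>\<^sub>M p\<in>I. borel)"
    by simp
  have "(\<integral>\<^sup>+\<omega>. g (X k \<omega>) (X l \<omega>) (X m \<omega>) (X i \<omega>) (X j \<omega>) \<partial>M) =
    (\<integral>\<^sup>+x. g (x k) (x l) (x m) (x i) (x j) \<partial>distr M (\<Pi>\<^sub>M p\<in>I. borel) (\<lambda>\<omega>. \<lambda>p\<in>I. X p \<omega>))"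
    using g' borel_measurable_gaussian
    by (subst nn_integral_distr) (auto simp: I intro!: measurable_restrict)
  also have "\<dots> = (\<integral>\<^sup>+x. g (x k) (x l) (x m) (x i) (x j) \<partial>Pi\<^sub>M {k, l, m, i, j} (\<lambda>_. std_gaussian))"
    unfolding PiM by (simp add: I)
  finally show ?thesis
    by (simp only: nn_integral_PiM_std_gaussian_5[OF g dist])
qed

end

context
  fixes X :: "'i \<Rightarrow> 'a \<Rightarrow> real ^ 3" and I i j k l m and w :: "'a \<Rightarrow> real"
  assumes indep: "indep_vars (\<lambda>_. borel) X I"
    and gauss: "\<And>i. i \<in> I \<Longrightarrow> distributed M lborel (X i) (\<lambda>x. ennreal (std_gaussian_density x))"
    and dist: "distinct [k, l, m, i, j]" and I: "I = {k, l, m, i, j}"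
    and w: "\<And>\<omega>. w \<omega> = plane_side (X k \<omega>) (X l \<omega>) (X m \<omega>) (X i \<omega>) *
      plane_side (X k \<omega>) (X l \<omega>) (X m \<omega>) (X j \<omega>)"
begin

lemma borel_measurable_plane_sides: "w \<in> borel_measurable M"
proof -
  have [measurable]: "X p \<in> borel_measurable M" if "p \<in> I" for p
    using gauss[OF that] distributed_measurable by fastforce
  have "(\<lambda>\<omega>. plane_side (X k \<omega>) (X l \<omega>) (X m \<omega>) (X i \<omega>) *
      plane_side (X k \<omega>) (X l \<omega>) (X m \<omega>) (X j \<omega>)) \<in> borel_measurable M"
    unfolding plane_side_def by (measurable; simp add: I)
  then show ?thesis by (simp only: w[abs_def])
qed

lemma prob_opposite_sides: "prob {\<omega> \<in> space M. w \<omega> \<le> 0} = 1 / 2 - arcsin (1 / 4) / pi"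
proof -
  have [measurable]: "w \<in> borel_measurable M" by (rule borel_measurable_plane_sides)
  have "emeasure M {\<omega> \<in> space M. w \<omega> \<le> 0} = (\<integral>\<^sup>+\<omega>. indicator {\<omega> \<in> space M. w \<omega> \<le> 0} \<omega> \<partial>M)"
    by simp
  also have "\<dots> = (\<integral>\<^sup>+\<omega>. indicator {x. x \<le> 0} (w \<omega>) \<partial>M)"
    by (intro nn_integral_cong) (simp add: indicator_def)
  also have "\<dots> = (\<integral>\<^sup>+c. \<integral>\<^sup>+d. \<integral>\<^sup>+e. \<integral>\<^sup>+x. \<integral>\<^sup>+y.
      indicator {x. x \<le> 0} (((x - c) \<bullet> cross3 (d - c) (e - c)) * ((y - c) \<bullet> cross3 (d - c) (e - c)))
      \<partial>std_gaussian \<partial>std_gaussian \<partial>std_gaussian \<partial>std_gaussian \<partial>std_gaussian)"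
    unfolding w plane_side_def
    by (rule nn_integral_gaussian_5[OF indep gauss _ dist I]) measurable
  also have "\<dots> = ennreal (2 / pi * arctan (sqrt (3 / 5)))"
    by (rule std_gaussian_opposite_sides_random_plane)
  finally show ?thesis
    by (simp add: measure_def two_arctan_sqrt_three_fifths[symmetric])
qed

text \<open>The points are fixed one after another: almost surely \<open>d\<close> differs from
  \<open>c\<close>, then \<open>e\<close> is off their line, then \<open>x\<close> and
  \<open>y\<close> are off the plane. At each level the remaining integral of the zero set
  vanishes.\<close>

lemma AE_plane_sides_nonzero: "AE \<omega> in M. w \<omega> \<noteq> 0"
proof -
  have [measurable]: "w \<in> borel_measurable M" by (rule borel_measurable_plane_sides)
  let ?G = "std_gaussian :: (real^3) measure"
  let ?f = "\<lambda>c d e x y::real^3. indicator {0} (((x - c) \<bullet> cross3 (d - c) (e - c)) * ((y - c) \<bullet> cross3 (d - c) (e - c))) :: ennreal"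
  have plane: "AE x in ?G. (x - c) \<bullet> n \<noteq> 0" if "n \<noteq> 0" for c n
    using AE_std_gaussian_not_hyperplane[OF that, of "n \<bullet> c"]
    by eventually_elim (simp add: inner_diff_left inner_commute[of n])
  have y: "(\<integral>\<^sup>+y. ?f c d e x y \<partial>?G) = 0"
    if "cross3 (d - c) (e - c) \<noteq> 0" "(x - c) \<bullet> cross3 (d - c) (e - c) \<noteq> 0" for c d e x
  proof -
    have "AE y in ?G. ?f c d e x y = 0"
      using plane[OF that(1), of c] by eventually_elim (use that(2) in simp)
    then show ?thesis by (simp add: nn_integral_cong_AE)
  qed
  have x: "(\<integral>\<^sup>+x. \<integral>\<^sup>+y. ?f c d e x y \<partial>?G \<partial>?G) = 0" if "cross3 (d - c) (e - c) \<noteq> 0" for c d e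
  proof -
    have "AE x in ?G. (\<integral>\<^sup>+y. ?f c d e x y \<partial>?G) = 0"
      using plane[OF that, of c] by eventually_elim (rule y[OF that])
    then show ?thesis by (subst nn_integral_cong_AE[where v="\<lambda>_. 0"]) auto
  qed
  have e: "(\<integral>\<^sup>+e. \<integral>\<^sup>+x. \<integral>\<^sup>+y. ?f c d e x y \<partial>?G \<partial>?G \<partial>?G) = 0" if "d \<noteq> c" for c d
  proof -
    from that have "d - c \<noteq> 0" by simp
    from AE_std_gaussian_cross3[OF this, of c]
    have "AE e in ?G. (\<integral>\<^sup>+x. \<integral>\<^sup>+y. ?f c d e x y \<partial>?G \<partial>?G) = 0"
      by eventually_elim (rule x)
    then show ?thesis by (subst nn_integral_cong_AE[where v="\<lambda>_. 0"]) auto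
  qed
  have d: "(\<integral>\<^sup>+d. \<integral>\<^sup>+e. \<integral>\<^sup>+x. \<integral>\<^sup>+y. ?f c d e x y \<partial>?G \<partial>?G \<partial>?G \<partial>?G) = 0" for c
  proof -
    have "AE d in ?G. (\<integral>\<^sup>+e. \<integral>\<^sup>+x. \<integral>\<^sup>+y. ?f c d e x y \<partial>?G \<partial>?G \<partial>?G) = 0"
      using AE_std_gaussian_neq[of c] by eventually_elim (rule e)
    then show ?thesis by (subst nn_integral_cong_AE[where v="\<lambda>_. 0"]) auto
  qed
  have "(\<integral>\<^sup>+\<omega>. indicator {0} (w \<omega>) \<partial>M) =
    (\<integral>\<^sup>+c. \<integral>\<^sup>+d. \<integral>\<^sup>+e. \<integral>\<^sup>+x. \<integral>\<^sup>+y. ?f c d e x y \<partial>?G \<partial>?G \<partial>?G \<partial>?G \<partial>?G)"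
    unfolding w plane_side_def
    by (rule nn_integral_gaussian_5[OF indep gauss _ dist I]) measurable
  also have "\<dots> = 0" by (simp only: d nn_integral_0_iff_AE) simp
  finally have "AE \<omega> in M. (indicator {0} (w \<omega>) :: ennreal) = 0"
    by (subst (asm) nn_integral_0_iff_AE) auto
  then show ?thesis by eventually_elim (auto simp: indicator_def split: if_splits)
qed

end

text \<open>Expectation is linear, so the 20 ordered pairs may depend on each other arbitrarily.
  With s the probability for one pair and P the wanted one, 20 s = 12 - 4 P.\<close>

lemma prob_convex_position:
  fixes X :: "'i \<Rightarrow> 'a \<Rightarrow> real ^ 3"
  assumes card: "card I = 5"
    and indep: "indep_vars (\<lambda>_. borel) X I"
    and gauss: "\<And>i. i \<in> I \<Longrightarrow> distributed M lborel (X i) (\<lambda>x. ennreal (std_gaussian_density x))"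
  shows "prob {\<omega> \<in> space M. convex_position I (\<lambda>i. X i \<omega>)} = 1 / 2 + 5 / pi * arcsin (1 / 4)"
proof -
  have [simp]: "finite I" using card by (simp add: card_ge_0_finite)
  have "\<exists>k l m. I = {i, j, k, l, m}" if "i \<in> I" "j \<in> I" "i \<noteq> j" for i j
  proof -
    have "card (I - {i, j}) = 3" using that card by (simp add: card_Diff_subset)
    then obtain k l m where "I - {i, j} = {k, l, m}" by (auto simp: card_3_iff)
    then have "I = {i, j, k, l, m}" using that by auto
    then show ?thesis by blast
  qed
  \<comment> \<open>Choice functions for the complementary triple of each ordered pair.\<close>
  then obtain k l m where I: "\<And>i j. \<lbrakk>i \<in> I; j \<in> I; i \<noteq> j\<rbrakk> \<Longrightarrow> I = {i, j, k i j, l i j, m i j}"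
    by metis
  have dist: "distinct [k i j, l i j, m i j, i, j]" if "i \<in> I" "j \<in> I" "i \<noteq> j" for i j
  proof -
    have "{k i j, l i j, m i j, i, j} = I" using I[OF that] by auto
    then show ?thesis using card by (intro card_distinct) simp
  qed
  have I': "I = {k i j, l i j, m i j, i, j}" if "i \<in> I" "j \<in> I" "i \<noteq> j" for i j
    using I[OF that] by auto
  define w where "w i j \<omega> = plane_side (X (k i j) \<omega>) (X (l i j) \<omega>) (X (m i j) \<omega>) (X i \<omega>) *
      plane_side (X (k i j) \<omega>) (X (l i j) \<omega>) (X (m i j) \<omega>) (X j \<omega>)" for i j \<omega>
  let ?A = "{(i, j). i \<in> I \<and> j \<in> I \<and> i \<noteq> j}"
  let ?C = "{\<omega> \<in> space M. convex_position I (\<lambda>i. X i \<omega>)}"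
  have [simp]: "finite ?A" by (rule finite_subset[of _ "I \<times> I"]) auto
  have "card ?A = 20"
  proof -
    have "?A = I \<times> I - (\<lambda>i. (i, i)) ` I" by auto
    then show ?thesis
      by (simp only:) (subst card_Diff_subset, auto simp: card_image inj_on_def card_cartesian_product card)
  qed
  have meas [measurable]: "w i j \<in> borel_measurable M" if "(i, j) \<in> ?A" for i j
    using that by (intro borel_measurable_plane_sides[OF indep gauss dist I' w_def]) auto
  have [measurable]: "?C \<in> events"
    using pred_convex_position[of I X M] borel_measurable_gaussian[OF indep gauss] by (simp add: pred_def)
  have "AE \<omega> in M. \<forall>p\<in>?A. w (fst p) (snd p) \<omega> \<noteq> 0"
    using AE_plane_sides_nonzero[OF indep gauss dist I' w_def]
    by (intro AE_finite_allI) auto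
  \<comment> \<open>The closed events \<open>\<le> 0\<close> may be counted as strict ones because
    no product vanishes almost surely; the count is then 8 in convex position and 12
    otherwise.\<close>
  then have count: "AE \<omega> in M. (\<Sum>p\<in>?A. indicator {\<omega> \<in> space M. w (fst p) (snd p) \<omega> \<le> 0} \<omega>) = 12 - 4 * (indicator ?C \<omega> :: real)"
    using AE_space
  proof eventually_elim
    case (elim \<omega>)
    have "(\<Sum>p\<in>?A. indicator {\<omega> \<in> space M. w (fst p) (snd p) \<omega> \<le> 0} \<omega>) =
      (\<Sum>p\<in>?A. if w (fst p) (snd p) \<omega> < 0 then 1 else (0 :: real))"
      using elim by (intro sum.cong) (force simp: indicator_def less_le)+
    also have "\<dots> = real (card {p \<in> ?A. w (fst p) (snd p) \<omega> < 0})"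
      by (simp add: sum.If_cases Int_def)
    also have "{p \<in> ?A. w (fst p) (snd p) \<omega> < 0} = {(i, j). i \<in> I \<and> j \<in> I \<and> i \<noteq> j \<and> w i j \<omega> < 0}"
      by auto
    also have "card \<dots> = (if convex_position I (\<lambda>i. X i \<omega>) then 8 else 12)"
      by (rule card_opposite_side_pairs[OF card I w_def]) (use elim in auto)
    also have "real \<dots> = 12 - 4 * indicator ?C \<omega>"
      using elim by (simp add: indicator_def)
    finally show ?case .
  qed
  have "20 * (1 / 2 - arcsin (1 / 4) / pi) = (\<Sum>p\<in>?A. prob {\<omega> \<in> space M. w (fst p) (snd p) \<omega> \<le> 0})"
    using prob_opposite_sides[OF indep gauss dist I' w_def] \<open>card ?A = 20\<close>
    by (subst sum.cong[OF refl, of _ _ "\<lambda>_. 1 / 2 - arcsin (1 / 4) / pi"]) auto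
  also have "\<dots> = (\<Sum>p\<in>?A. expectation (indicator {\<omega> \<in> space M. w (fst p) (snd p) \<omega> \<le> 0}))"
    using meas by (intro sum.cong) auto
  also have "\<dots> = expectation (\<lambda>\<omega>. \<Sum>p\<in>?A. indicator {\<omega> \<in> space M. w (fst p) (snd p) \<omega> \<le> 0} \<omega>)"
    using meas by (subst Bochner_Integration.integral_sum)
      (auto intro!: integrable_real_indicator simp: less_top[symmetric])
  also have "\<dots> = expectation (\<lambda>\<omega>. 12 - 4 * indicator ?C \<omega>)"
    using count meas by (intro integral_cong_AE) auto
  also have "\<dots> = 12 - 4 * prob ?C"
    by (subst Bochner_Integration.integral_diff)
      (auto intro!: integrable_real_indicator simp: prob_space less_top[symmetric])
  finally show ?thesis by (simp add: field_simps)
qed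

end

section \<open>Numerical value\<close>

text \<open>The cubic Taylor polynomial of sine with error at most x^5 / 120 is evaluated at both
  endpoints, and the comparison with 1/4 is inverted by monotonicity.\<close>

lemma arcsin_one_fourth_bounds: "0.2526 \<le> arcsin (1 / 4 :: real)" "arcsin (1 / 4 :: real) \<le> 0.2528"
proof -
  have sin: "\<bar>sin x - (x - x ^ 3 / 6)\<bar> \<le> \<bar>x\<bar> ^ 5 / 120" for x :: real
    using Maclaurin_sin_bound[of x 5] by (simp add: lessThan_nat_numeral sin_coeff_def fact_numeral)
  have "sin x \<le> x - x ^ 3 / 6 + \<bar>x\<bar> ^ 5 / 120" "x - x ^ 3 / 6 - \<bar>x\<bar> ^ 5 / 120 \<le> sin x" for x :: real
    using sin[of x] by linarith+
  from this(1)[of "0.2526"] this(2)[of "0.2528"]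
  have "sin (0.2526 :: real) \<le> 1 / 4" "1 / 4 \<le> sin (0.2528 :: real)"
    by (simp_all add: power_divide)
  then show "0.2526 \<le> arcsin (1 / 4 :: real)" "arcsin (1 / 4 :: real) \<le> 0.2528"
    using iffD2[OF le_arcsin_iff[of "1 / 4" "0.2526"]] iffD2[OF arcsin_le_iff[of "1 / 4" "0.2528"]] pi_gt3
    by simp_all
qed

theorem corollary5:
  fixes M :: "'w measure"
    and X :: "nat \<Rightarrow> 'w \<Rightarrow> real ^ 3"
  assumes "prob_space M"
    and "prob_space.indep_vars M (\<lambda>_. borel) X {..<5}"
    and "\<And>i. i < 5 \<Longrightarrow> distributed M lborel (X i) (\<lambda>x. ennreal (std_gaussian_density x))"
  shows "\<P>(\<omega> in M. convex_position {..<5} (\<lambda>i. X i \<omega>)) =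
           \<P>(\<omega> in M. radon_smaller_side {..<5} (\<lambda>i. X i \<omega>) = 2) \<and>
         \<P>(\<omega> in M. radon_smaller_side {..<5} (\<lambda>i. X i \<omega>) = 2) =
           1 / 2 + 5 / pi * arcsin (1 / 4) \<and>
         \<bar>(1 / 2 + 5 / pi * arcsin (1 / 4)) - 0.902\<bar> < (0.0005 :: real)"
proof -
  have "radon_smaller_side {..<5} (\<lambda>i. X i \<omega>) = 2 \<longleftrightarrow> convex_position {..<5} (\<lambda>i. X i \<omega>)" for \<omega>
    by (rule radon_smaller_side_eq_2_iff) auto
  moreover have "\<P>(\<omega> in M. convex_position {..<5} (\<lambda>i. X i \<omega>)) = 1 / 2 + 5 / pi * arcsin (1 / 4)"
    using assms by (intro prob_space.prob_convex_position) auto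
  moreover have "\<bar>(1 / 2 + 5 / pi * arcsin (1 / 4)) - 0.902\<bar> < (0.0005 :: real)"
  proof -
    \<comment> \<open>The bounds 0.0804 and 0.0805 are the values of \<open>q\<close> at which
      \<open>1 / 2 + 5 * q\<close> equals 0.902 and 0.9025; the probability lies slightly above
      0.902, so this one-sided range suffices.\<close>
    have "0.0804 * pi < 0.2526" "0.2528 < 0.0805 * pi" using pi_approx by simp_all
    then have "0.0804 * pi < arcsin (1 / 4)" "arcsin (1 / 4) < 0.0805 * pi"
      using arcsin_one_fourth_bounds by linarith+
    then have "0.0804 < arcsin (1 / 4) / pi" "arcsin (1 / 4) / pi < 0.0805"
      by (simp_all add: field_simps)
    moreover have "5 / pi * arcsin (1 / 4) = 5 * (arcsin (1 / 4) / pi)"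
      by simp
    moreover have "\<bar>1 / 2 + 5 * q - 0.902\<bar> < 0.0005" if "0.0804 < q" "q < 0.0805" for q :: real
      using that unfolding abs_less_iff by (simp add: field_simps)
    ultimately show ?thesis by metis
  qed
  ultimately show ?thesis by simp
qed

end
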